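(* The map $\Psi$ from parallelogram polyominoes to binary trees and the map $\Lambda$ from binary trees to parallelogram polyominoes, both defined in the context, are inverse of one another.
   Context: **Grid and trees.** $\mathbb{N}=\{0,1,2,\dots\}$. Points (cells, boxes) have coordinates $(X,Y)\in\mathbb{N}\times\mathbb{N}$; the $x$-axis points south-west and the $y$-axis points south-east. A row is a set of cells with fixed $X$, a column is a set of cells with fixed $Y$. A binary tree is a finite nonempty rooted tree in which each vertex has at most one left child and at most one right child (considered up to isomorphism); edges are oriented away from the root, and an edge to a left (resp. right) child is a left (resp. right) edge. A vertex is considered a descendant of each vertex on the path from the root to it. **Non-ambiguous trees.** A non-ambiguous tree of size $n$ is a set $A$ of $n$ points of $\mathbb{N}\times\mathbb{N}$ such that: (1) $(0,0)\in A$ (the root); (2) for each non-root $p\in A$, exactly one of the following holds: there is $q\in A$ with $X(q)=X(p)$, $Y(q)<Y(p)$; there is $r\in A$ with $Y(r)=Y(p)$, $X(r)<X(p)$; (3) if some $p\in A$ has $X(p)=x$ (resp. $Y(p)=y$), then for every $0\le x'<x$ (resp. $0\le y'<y$) some $q\in A$ has $X(q)=x'$ (resp. $Y(q)=y'$). The underlying binary tree of $A$ has vertex set $A$ and root $(0,0)$; the parent of a non-root $p$ is the nearest point of $A$ preceding $p$ in its row (then $p$ is a right child) or in its column (then $p$ is a left child). **Parallelogram polyominoes and $\Psi$.** A parallelogram polyomino of size $n\ge 1$ is a pair of lattice paths of length $n+1$ with south-west steps $(+1,0)$ and south-east steps $(0,+1)$, starting at the same point $(0,0)$, ending at the same point,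 and not meeting otherwise. It is identified with the set of unit boxes enclosed by the two paths, the box $[x,x+1]\times[y,y+1]$ having coordinates $(x,y)$ (so its northernmost box is $(0,0)$). For a parallelogram polyomino $P$, $S(P)$ is the set of boxes $(x,y)\in P$ that have smallest $Y$-coordinate among the boxes of $P$ in row $X=x$, or smallest $X$-coordinate among the boxes of $P$ in column $Y=y$. The set $S(P)$ is a non-ambiguous tree, and $\Psi(P)$ is its underlying binary tree. If $P$ has size $n$, $\Psi(P)$ has $n$ vertices. **The map $\Lambda$.** Let $T$ be a binary tree, and let $T_r$ be obtained by grafting $T$ as the right child of a new vertex $r$ (the virtual root). For a vertex $s$ of $T$, let $\mathcal{P}$ be the path from $r$ to $s$ in $T_r$; $\mathcal{P}$ turns at an intermediate vertex if the edges of $\mathcal{P}$ entering and leaving it are of different types (one left, one right); it takes a left (resp. right) turn there if the leaving edge is left (resp. right). Let $t(s)$ be the number of turns of $\mathcal{P}$, and let $s_1,\dots,s_k$ be the vertices where $\mathcal{P}$ turns. Let $E(T,s)$ be the set of all vertices $x$ of $T$ except those for which $x\ne s$ is a descendant of $s$, or $x$ belongs to the right (resp. left) subtree of some $s_i$ at which $\mathcal{P}$ takes a left (resp. right) turn. Put $z(s)=|E(T,s)|$; $z$ is a bijection from the vertices of $T$ to $\{1,\dots,n\}$, $n$ being the number of vertices of $T$. Let $V_L$ (resp. $V_R$) be the set of end points of left (resp. right) edges of $T$. Let $\alpha_L$ (resp. $\alpha_R$) be the total order on $V_L$ (resp. $V_R$) in which $u$ precedes $v$ iff $(t(u),z(u))<(t(v),z(v))$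 lexicographically. Place the root of $T$ at $(0,0)$; each $v\in V_L$ with $X(v)$ equal to the position ($1,2,\dots$) of $v$ in $\alpha_L$ and $Y(v)=Y(\text{parent}(v))$; and each $v\in V_R$ with $X(v)=X(\text{parent}(v))$ and $Y(v)$ equal to the position of $v$ in $\alpha_R$. The resulting set of points is a non-ambiguous tree $A(T)$ with underlying binary tree $T$. The filling of a non-ambiguous tree $A$ is $$F(A)=A\cup\{(x_1,y_2): \exists\, (x_1,y_1),(x_2,y_2)\in A \text{ with } x_1>x_2,\ y_1<y_2\}.$$ Finally $\Lambda(T)=F(A(T))$, which is a parallelogram polyomino. *)

theory Defs
  imports Main "HOL-Library.FuncSet" "HOL-Library.Sublist" "HOL-Library.Tree"
begin

type_synonym cell = "nat \<times> nat"

subsection \<open>Binary trees\<close>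

text \<open>
  A binary tree up to isomorphism is a non-leaf value of type \<open>unit tree\<close>, where the constructor
  \<open>Leaf\<close> stands for an absent child.  A vertex is named by its address, the word of edge types on
  the path from the root to it.  Thus the root is \<open>[]\<close>, the parent of \<open>v \<noteq> []\<close> is \<open>butlast v\<close>, the
  type of the edge entering \<open>v\<close> is \<open>last v\<close>, and the descendants of \<open>v\<close> (including \<open>v\<close>) are the
  vertices of which \<open>v\<close> is a prefix.
\<close>

datatype dir = Lft | Rgt

type_synonym vertex = "dir list"

definition binary_trees :: "unit tree set" where
  "binary_trees = {T. T \<noteq> Leaf}"

fun vertices :: "'a tree \<Rightarrow> vertex set" where
  "vertices Leaf = {}"
| "vertices (Node l a r) = insert [] ((#) Lft ` vertices l \<union> (#) Rgt ` vertices r)"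

subsection \<open>Non-ambiguous trees\<close>

definition non_ambiguous_tree :: "cell set \<Rightarrow> bool" where
  "non_ambiguous_tree A \<longleftrightarrow>
     finite A \<and>
     (0, 0) \<in> A \<and>
     (\<forall>p\<in>A. p \<noteq> (0, 0) \<longrightarrow>
        (\<exists>q\<in>A. fst q = fst p \<and> snd q < snd p) \<noteq> (\<exists>r\<in>A. snd r = snd p \<and> fst r < fst p)) \<and>
     (\<forall>p\<in>A. (\<forall>x'<fst p. \<exists>q\<in>A. fst q = x') \<and> (\<forall>y'<snd p. \<exists>q\<in>A. snd q = y'))"

fun child_in :: "cell set \<Rightarrow> dir \<Rightarrow> cell \<Rightarrow> cell \<Rightarrow> bool" where
  "child_in A Rgt q p \<longleftrightarrow>
     q \<in> A \<and> p \<in> A \<and> fst q = fst p \<and> snd q < snd p \<and>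
     \<not> (\<exists>q'\<in>A. fst q' = fst p \<and> snd q < snd q' \<and> snd q' < snd p)"
| "child_in A Lft q p \<longleftrightarrow>
     q \<in> A \<and> p \<in> A \<and> snd q = snd p \<and> fst q < fst p \<and>
     \<not> (\<exists>q'\<in>A. snd q' = snd p \<and> fst q < fst q' \<and> fst q' < fst p)"

text \<open>\<open>T\<close> is isomorphic, as a rooted tree with left and right edges, to the tree carried by \<open>A\<close>.\<close>

definition is_underlying_tree :: "cell set \<Rightarrow> unit tree \<Rightarrow> bool" where
  "is_underlying_tree A T \<longleftrightarrow>
     non_ambiguous_tree A \<and> T \<in> binary_trees \<and>
     (\<exists>f. bij_betw f (vertices T) A \<and> f [] = (0, 0) \<and>
          (\<forall>u\<in>vertices T. \<forall>v\<in>vertices T. \<forall>d. v = u @ [d] \<longleftrightarrow> child_in A d (f u) (f v)))"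

definition underlying_tree :: "cell set \<Rightarrow> unit tree" where
  "underlying_tree A = (THE T. is_underlying_tree A T)"

subsection \<open>Parallelogram polyominoes and the map \<open>\<Psi>\<close>\<close>

text \<open>South-west steps are \<open>(+1, 0)\<close> and south-east steps are \<open>(0, +1)\<close>; all paths start at \<open>(0, 0)\<close>.\<close>

datatype step = SW | SE

definition endpoint :: "step list \<Rightarrow> nat \<times> nat" where
  "endpoint w = (count_list w SW, count_list w SE)"

definition path_points :: "step list \<Rightarrow> (nat \<times> nat) set" where
  "path_points w = {endpoint (take i w) | i. i \<le> length w}"

definition has_sw_step_at :: "step list \<Rightarrow> nat \<times> nat \<Rightarrow> bool" where
  "has_sw_step_at w p \<longleftrightarrow> (\<exists>i<length w. w ! i = SW \<and> endpoint (take i w) = p)"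

definition bounding_paths :: "nat \<Rightarrow> step list \<Rightarrow> step list \<Rightarrow> bool" where
  "bounding_paths n u v \<longleftrightarrow>
     n \<ge> 1 \<and> length u = n + 1 \<and> length v = n + 1 \<and> endpoint u = endpoint v \<and>
     path_points u \<inter> path_points v = {(0, 0), endpoint u}"

text \<open>
  Each path crosses the strip between \<open>X = x\<close> and \<open>X = x + 1\<close> by at most one south-west step.
  A box \<open>[x, x + 1] \<times> [y, y + 1]\<close> is enclosed iff, within its strip, it lies between the crossings
  of the two paths.  Which of the two paths is the western one is left open.
\<close>

definition enclosed_boxes :: "step list \<Rightarrow> step list \<Rightarrow> cell set" where
  "enclosed_boxes u v =
     {(x, y). \<exists>a b. has_sw_step_at u (x, a) \<and> has_sw_step_at v (x, b) \<and> min a b \<le> y \<and> y < max a b}"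

definition parallelogram_polyominoes :: "cell set set" where
  "parallelogram_polyominoes = {enclosed_boxes u v | u v n. bounding_paths n u v}"

definition border_boxes :: "cell set \<Rightarrow> cell set" where
  "border_boxes P =
     {(x, y) \<in> P. (\<forall>y'. (x, y') \<in> P \<longrightarrow> y \<le> y') \<or> (\<forall>x'. (x', y) \<in> P \<longrightarrow> x \<le> x')}"

definition Psi :: "cell set \<Rightarrow> unit tree" where
  "Psi P = underlying_tree (border_boxes P)"

subsection \<open>The map \<open>\<Lambda>\<close>\<close>

text \<open>
  In the tree \<open>T\<close> grafted as the right child of the virtual root, the path from the virtual root
  to the vertex \<open>s\<close> of \<open>T\<close> has the edge word \<open>Rgt # s\<close>.  Its intermediate vertices are
  \<open>take i s\<close> for \<open>i < length s\<close>; the entering edge there is \<open>(Rgt # s) ! i\<close> and the leaving edge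
  is \<open>s ! i\<close>.
\<close>

definition turns :: "vertex \<Rightarrow> nat set" where
  "turns s = {i. i < length s \<and> (Rgt # s) ! i \<noteq> s ! i}"

definition turn_count :: "vertex \<Rightarrow> nat" where
  "turn_count s = card (turns s)"

definition E_set :: "'a tree \<Rightarrow> vertex \<Rightarrow> vertex set" where
  "E_set T s =
     {x \<in> vertices T.
        \<not> (x \<noteq> s \<and> prefix s x) \<and>
        \<not> (\<exists>i\<in>turns s. (s ! i = Lft \<and> prefix (take i s @ [Rgt]) x) \<or>
                        (s ! i = Rgt \<and> prefix (take i s @ [Lft]) x))}"

definition z_index :: "'a tree \<Rightarrow> vertex \<Rightarrow> nat" where
  "z_index T s = card (E_set T s)"

definition edge_ends :: "'a tree \<Rightarrow> dir \<Rightarrow> vertex set" where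
  "edge_ends T d = {v \<in> vertices T. v \<noteq> [] \<and> last v = d}"

definition precedes :: "'a tree \<Rightarrow> vertex \<Rightarrow> vertex \<Rightarrow> bool" where
  "precedes T u v \<longleftrightarrow>
     turn_count u < turn_count v \<or> (turn_count u = turn_count v \<and> z_index T u < z_index T v)"

definition position :: "'a tree \<Rightarrow> dir \<Rightarrow> vertex \<Rightarrow> nat" where
  "position T d v = card {u \<in> edge_ends T d. precedes T u v} + 1"

function place :: "'a tree \<Rightarrow> vertex \<Rightarrow> cell" where
  "place T [] = (0, 0)"
| "place T (v @ [Lft]) = (position T Lft (v @ [Lft]), snd (place T v))"
| "place T (v @ [Rgt]) = (fst (place T v), position T Rgt (v @ [Rgt]))"
  by (auto, metis (full_types) dir.exhaust rev_exhaust)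
termination
  by (relation "measure (\<lambda>(T, v). length v)") auto

definition place_tree :: "'a tree \<Rightarrow> cell set" where
  "place_tree T = place T ` vertices T"

definition filling :: "cell set \<Rightarrow> cell set" where
  "filling A = A \<union> {(x1, y2) | x1 y1 x2 y2. (x1, y1) \<in> A \<and> (x2, y2) \<in> A \<and> x1 > x2 \<and> y1 < y2}"

definition Lambda :: "unit tree \<Rightarrow> cell set" where
  "Lambda T = filling (place_tree T)"

end

theory Submission
  imports Defs
begin

text \<open>
  The breadth-first numbering behind \<open>\<Lambda>\<close> is a total order on words which does not depend on the
  tree: words are compared by their number of turns, and then lexicographically, a turn being
  smaller than no turn.  In this order, the chains of equally directed edges are enumerated one after
  another, in the order of the vertices from which they hang.

  Call a non-ambiguous tree a staircase if the leftmost cells of its rows move weakly to the right as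
  one goes down, and the topmost cells of its columns move weakly down as one goes to the right.  Then \<open>S\<close>
  and the filling are inverse bijections between parallelogram polyominoes and staircases.
  If a tree is drawn as a staircase, the staircase condition and the enumeration of chains force, by induction
  on the depth, the order of the rows and columns to be that of the numbering, so the drawing is
  \<open>A(T)\<close>; conversely \<open>A(T)\<close> is a staircase.
\<close>

subsection \<open>The turn order on words\<close>

fun opp :: "dir \<Rightarrow> dir" where
  "opp Lft = Rgt"
| "opp Rgt = Lft"

lemma opp_opp [simp]: "opp (opp d) = d"
  by (cases d) auto

lemma opp_neq [simp]: "opp d \<noteq> d" "d \<noteq> opp d"
  by (cases d; simp)+

lemma opp_eq_iff [simp]: "opp d = opp e \<longleftrightarrow> d = e"
  by (cases d; cases e) auto

lemma neq_iff_opp: "e \<noteq> d \<longleftrightarrow> e = opp d"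
  by (cases d; cases e) auto

lemma all_dir_iff: "(\<forall>d. Q d) \<longleftrightarrow> Q d \<and> Q (opp d)"
  by (metis neq_iff_opp)

text \<open>Here and below, \<open>d\<close> is the direction of the edge entering the first vertex of the word, which
  is \<open>Rgt\<close> for the path from the virtual root.\<close>

fun turns_from :: "dir \<Rightarrow> vertex \<Rightarrow> nat" where
  "turns_from d [] = 0"
| "turns_from d (a # s) = (if a = d then 0 else 1) + turns_from a s"

text \<open>At the first difference exactly one of the two letters differs from the entering
  direction \<open>d\<close>, and the word that turns there comes first. A word comes before its
  proper extensions. On the vertices of a tree, \<open>z\<close> will turn out to count along this
  order.\<close>

fun turn_first :: "dir \<Rightarrow> vertex \<Rightarrow> vertex \<Rightarrow> bool" where
  "turn_first d [] v \<longleftrightarrow> v \<noteq> []"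
| "turn_first d (a # u) [] \<longleftrightarrow> False"
| "turn_first d (a # u) (b # v) \<longleftrightarrow> (if a = b then turn_first a u v else a \<noteq> d)"

definition prec :: "vertex \<Rightarrow> vertex \<Rightarrow> bool" where
  "prec u v \<longleftrightarrow> turns_from Rgt u < turns_from Rgt v
     \<or> (turns_from Rgt u = turns_from Rgt v \<and> turn_first Rgt u v)"

lemma turn_first_irrefl: "\<not> turn_first d u u"
  by (induction u arbitrary: d) auto

lemma turn_first_trans: "turn_first d u v \<Longrightarrow> turn_first d v w \<Longrightarrow> turn_first d u w"
proof (induction d u v arbitrary: w rule: turn_first.induct)
  case (1 d v)
  then show ?case by (cases v; cases w) auto
next
  case (3 d a u b v)
  then show ?case
    by (cases w) (auto split: if_splits simp: neq_iff_opp)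
qed simp

lemma turn_first_total: "u \<noteq> v \<Longrightarrow> turn_first d u v \<or> turn_first d v u"
  by (induction d u v rule: turn_first.induct) (auto simp: neq_iff_opp)

lemma prec_irrefl [simp]: "\<not> prec u u"
  by (simp add: prec_def turn_first_irrefl)

lemma prec_trans: "prec u v \<Longrightarrow> prec v w \<Longrightarrow> prec u w"
  using turn_first_trans by (auto simp: prec_def)

lemma prec_total: "u \<noteq> v \<Longrightarrow> prec u v \<or> prec v u"
  using turn_first_total unfolding prec_def by (metis linorder_neqE_nat)

lemma turns_from_append: "turns_from d (s @ t) = turns_from d s + turns_from (last (d # s)) t"
  by (induction s arbitrary: d) auto

lemma turn_first_append_same: "turn_first d (s @ x) (s @ y) \<longleftrightarrow> turn_first (last (d # s)) x y"
  by (induction s arbitrary: d) auto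

text \<open>The hypothesis \<open>\<not> prefix u v\<close> puts the first difference inside both
  words, ahead of anything appended.\<close>

lemma turn_first_append: "turn_first d u v \<Longrightarrow> \<not> prefix u v \<Longrightarrow> turn_first d (u @ x) (v @ y)"
  by (induction d u v rule: turn_first.induct) (auto split: if_splits)

lemma turns_from_eq_0: "turns_from d s = 0 \<Longrightarrow> set s \<subseteq> {d}"
  by (induction s arbitrary: d) (auto split: if_splits)

lemma turns_from_replicate: "turns_from d (replicate k d) = 0"
  by (induction k) auto

lemma strict_prefix_prec: "strict_prefix u v \<Longrightarrow> prec u v"
  by (auto simp: prec_def turns_from_append turn_first_append_same[of _ _ "[]", simplified]
      elim!: strict_prefixE')

lemma Nil_prec [simp]: "prec [] v \<longleftrightarrow> v \<noteq> []"
  by (metis prec_irrefl strict_prefix_prec strict_prefix_simps(2) neq_Nil_conv)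

lemma not_prec_Nil [simp]: "\<not> prec v []"
  by (metis Nil_prec prec_irrefl prec_trans)

text \<open>This is the top vertex of the maximal chain of \<open>d\<close>-edges ending in
  \<open>v\<close>. In a drawing such a chain fills one row (\<open>d = Rgt\<close>) or one column
  (\<open>d = Lft\<close>), so equality of strips encodes lying in the same row or column.\<close>

definition strip :: "dir \<Rightarrow> vertex \<Rightarrow> vertex" where
  "strip d v = rev (dropWhile ((=) d) (rev v))"

lemma strip_Nil [simp]: "strip d [] = []"
  by (simp add: strip_def)

lemma strip_snoc: "strip d (v @ [e]) = (if e = d then strip d v else v @ [e])"
  by (simp add: strip_def)

lemma strip_snoc_same [simp]: "strip d (v @ [d]) = strip d v"
  and strip_snoc_opp [simp]: "strip (opp d) (v @ [d]) = v @ [d]"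
  by (simp_all add: strip_snoc)

lemma strip_decomp: "\<exists>k. v = strip d v @ replicate k d"
proof (induction v rule: rev_induct)
  case (snoc e v)
  then obtain k where "v = strip d v @ replicate k d" by blast
  then have "v @ [d] = strip d v @ replicate (Suc k) d"
    by (metis append.assoc replicate_append_same replicate_Suc)
  then show ?case
    by (cases "e = d") (metis strip_snoc, auto simp: strip_snoc intro: exI[of _ 0])
qed simp

lemma prefix_strip: "prefix (strip d v) v"
  by (metis strip_decomp prefixI)

lemma strip_last: "strip d v = [] \<or> last (strip d v) = opp d"
  by (induction v rule: rev_induct) (auto simp: strip_snoc neq_iff_opp)

lemma strip_eq_self: "v = [] \<or> last v = d \<Longrightarrow> strip (opp d) v = v"
  by (cases v rule: rev_cases) auto

lemma strip_eq_cases: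
  assumes "strip d u = strip d v"
  obtains i where "u = v @ replicate i d" | i where "v = u @ replicate i d"
proof -
  obtain j k where j: "u = strip d u @ replicate j d" and k: "v = strip d v @ replicate k d"
    using strip_decomp by blast
  show thesis
  proof (cases "j \<le> k")
    case True
    then have "replicate k d = replicate j d @ replicate (k - j) d"
      by (simp flip: replicate_add)
    then show thesis using that(2) j k assms by (metis append.assoc)
  next
    case False
    then have "replicate j d = replicate k d @ replicate (j - k) d"
      by (simp flip: replicate_add)
    then show thesis using that(1) j k assms by (metis append.assoc)
  qed
qed

text \<open>Every word equals one of its two strips, so each of \<open>u\<close> and
  \<open>v\<close> is a prefix of the other. In a drawing this says that the row and the column
  together determine the vertex.\<close>

lemma strip_strip_eqD:
  assumes "\<And>d. strip d u = strip d v"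
  shows "u = v"
proof -
  have *: "\<exists>d. strip d w = w" for w
  proof (cases w rule: rev_cases)
    case (snoc u e)
    then have "strip (opp e) w = w" by simp
    then show ?thesis by blast
  qed auto
  then show ?thesis
    by (metis assms prefix_order.antisym prefix_strip)
qed

lemma turns_from_neq_0: "s \<noteq> [] \<Longrightarrow> last s \<noteq> d \<Longrightarrow> turns_from d s > 0"
  using turns_from_eq_0 by (metis gr0I last_in_set singletonD subsetD)

text \<open>Chains of edges of direction \<open>d\<close> are enumerated one after another, in the order of their
  top vertices.\<close>

lemma prec_strip_imp_prec:
  assumes v: "v \<noteq> []" "last v = d" and v': "v' \<noteq> []" "last v' = d"
    and less: "prec (strip d v) (strip d v')"
  shows "prec v v'"
proof -
  define c c' where "c = strip d v" and "c' = strip d v'"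
  obtain k k' where k: "v = c @ replicate k d" and k': "v' = c' @ replicate k' d"
    unfolding c_def c'_def using strip_decomp by blast
  have c: "c = [] \<or> last c = opp d" and c': "c' = [] \<or> last c' = opp d"
    unfolding c_def c'_def using strip_last by auto
  have "k > 0" "k' > 0"
    using v v' k k' c c' by (metis append_Nil2 gr0I opp_neq(1) replicate_0)+
  then obtain x x' where x: "v = c @ d # x" "v' = c' @ d # x'"
    and x0: "turns_from d x = 0" "turns_from d x' = 0"
    using k k' by (metis gr0_implies_Suc replicate_Suc turns_from_replicate)
  \<comment> \<open>\<open>\<delta> c\<close> counts the turn made at \<open>c\<close> on entering
    the chain; the rest of the chain is straight. For a top vertex \<open>c\<close> it is 1 unless
    \<open>c\<close> is the root and \<open>d = Rgt\<close>.\<close>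
  define \<delta> where "\<delta> = (\<lambda>c::vertex. if last (Rgt # c) = d then 0 else 1 :: nat)"
  have t: "turns_from Rgt v = turns_from Rgt c + \<delta> c" "turns_from Rgt v' = turns_from Rgt c' + \<delta> c'"
    using x x0 by (auto simp: turns_from_append \<delta>_def)
  have "c' \<noteq> []" using less c_def c'_def by auto
  then have lc': "last c' = opp d" "\<delta> c' = 1" using c' by (auto simp: \<delta>_def)
  have less': "prec c c'" using less c_def c'_def by auto
  show ?thesis
  proof (cases "turns_from Rgt c < turns_from Rgt c'")
    case True
    moreover have "\<delta> c \<le> 1" by (simp add: \<delta>_def)
    ultimately show ?thesis using t lc' by (simp add: prec_def)
  next
    case False
    then have eq: "turns_from Rgt c = turns_from Rgt c'" and first: "turn_first Rgt c c'"
      using less' by (auto simp: prec_def)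
    \<comment> \<open>If \<open>c\<close> is the root, equal turn counts make \<open>c'\<close> a
      word in \<open>Rgt\<close> alone. As it ends in \<open>opp d\<close>, the direction
      \<open>d\<close> is \<open>Lft\<close>, and the chain below the root starts with a
      turn.\<close>
    have "\<delta> c = 1"
    proof (cases "c = []")
      case True
      then have "last c' = Rgt"
        using turns_from_neq_0[OF \<open>c' \<noteq> []\<close>, of Rgt] eq by auto
      then show ?thesis using lc' True by (auto simp: \<delta>_def)
    qed (use c in \<open>auto simp: \<delta>_def\<close>)
    then have "turns_from Rgt v = turns_from Rgt v'"
      using t lc' eq by simp
    moreover have "turn_first Rgt v v'"
    proof (cases "prefix c c'")
      case True
      then obtain w where w: "c' = c @ w" by (auto simp: prefix_def)
      have "w \<noteq> []" using first w turn_first_irrefl by auto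
      then obtain a w' where aw: "w = a # w'" by (cases w) auto
      \<comment> \<open>Equal turn counts make \<open>w\<close> straight, and it ends in
        \<open>opp d\<close>. So the path to \<open>v'\<close> goes straight on at \<open>c\<close>,
        while the path to \<open>v\<close> turns there and hence comes first.\<close>
      have "turns_from (last (Rgt # c)) w = 0" using eq w by (simp add: turns_from_append)
      then have s: "set w \<subseteq> {last (Rgt # c)}" by (rule turns_from_eq_0)
      have "last w = opp d" using lc' w \<open>w \<noteq> []\<close> by simp
      then have "last (Rgt # c) = opp d" using s \<open>w \<noteq> []\<close> by (metis last_in_set singletonD subsetD)
      moreover from this have "a = opp d" using s aw by auto
      ultimately show ?thesis
        using x w aw by (auto simp del: last.simps simp: turn_first_append_same)
    next
      case False
      then show ?thesis using first x by (simp add: turn_first_append)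
    qed
    ultimately show ?thesis by (simp add: prec_def)
  qed
qed

section \<open>Vertices of a tree and their numbering by \<open>z\<close>\<close>

lemma finite_vertices [simp]: "finite (vertices T)"
  by (induction T) auto

lemma vertices_prefix: "u @ s \<in> vertices T \<Longrightarrow> u \<in> vertices T"
proof (induction T arbitrary: u)
  case (Node l a r)
  then show ?case by (cases u) auto
qed simp

lemma vertices_prefix': "prefix u v \<Longrightarrow> v \<in> vertices T \<Longrightarrow> u \<in> vertices T"
  using vertices_prefix by (auto simp: prefix_def)

lemma Nil_in_vertices: "T \<in> binary_trees \<Longrightarrow> [] \<in> vertices T"
  by (cases T) (auto simp: binary_trees_def)

lemma strip_in_vertices: "v \<in> vertices T \<Longrightarrow> strip d v \<in> vertices T"
  using prefix_strip vertices_prefix' by blast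

lemma card_turns_from: "card {i. i < length s \<and> (d # s) ! i \<noteq> s ! i} = turns_from d s"
proof (induction s arbitrary: d)
  case (Cons a s)
  have "{i. i < length (a # s) \<and> (d # a # s) ! i \<noteq> (a # s) ! i}
      = (if a = d then {} else {0}) \<union> Suc ` {i. i < length s \<and> (a # s) ! i \<noteq> s ! i}"
    by (auto simp: image_iff less_Suc_eq_0_disj)
  also have "card \<dots> = (if a = d then 0 else 1) + turns_from a s"
    by (subst card_Un_disjoint) (auto simp: card_image Cons.IH)
  finally show ?case by simp
qed simp

lemma turn_count_eq: "turn_count s = turns_from Rgt s"
  unfolding turn_count_def turns_def by (rule card_turns_from)

text \<open>A vertex is excluded if it lies strictly below \<open>s\<close>, or leaves the path to
  \<open>s\<close> by going straight where the path turns. The others lie on the path or leave it by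
  turning where it goes straight.\<close>

lemma turn_first_iff_not_excluded:
  "(\<not> (x \<noteq> s \<and> prefix s x)
      \<and> \<not> (\<exists>i<length s. (d # s) ! i \<noteq> s ! i \<and> prefix (take i s @ [opp (s ! i)]) x))
    \<longleftrightarrow> x = s \<or> turn_first d x s"
proof (induction s arbitrary: d x)
  case Nil
  then show ?case by (cases x) auto
next
  case (Cons b s)
  show ?case
  proof (cases x)
    case (Cons a y)
    have *: "(\<exists>i<length (b # s). (d # b # s) ! i \<noteq> (b # s) ! i
          \<and> prefix (take i (b # s) @ [opp ((b # s) ! i)]) x)
        \<longleftrightarrow> (b \<noteq> d \<and> a = opp b) \<or> a = b \<and> (\<exists>i<length s. (b # s) ! i \<noteq> s ! i
          \<and> prefix (take i s @ [opp (s ! i)]) y)"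
      using Cons by (auto simp: Ex_less_Suc2)
    show ?thesis
      unfolding * using Cons.IH[of y b] Cons by (cases "a = b") (auto simp: neq_iff_opp)
  qed auto
qed

text \<open>The cases of left and right turns merge through \<open>opp\<close>. What remains is an
  initial segment of an order independent of \<open>T\<close>, so \<open>z_index\<close> is a rank
  in it.\<close>

lemma E_set_eq: "E_set T s = {x \<in> vertices T. x = s \<or> turn_first Rgt x s}"
proof -
  have "(\<exists>i\<in>turns s. (s ! i = Lft \<and> prefix (take i s @ [Rgt]) x) \<or>
                     (s ! i = Rgt \<and> prefix (take i s @ [Lft]) x))
     \<longleftrightarrow> (\<exists>i<length s. (Rgt # s) ! i \<noteq> s ! i \<and> prefix (take i s @ [opp (s ! i)]) x)" for x
  proof -
    have "(a = Lft \<and> prefix (w @ [Rgt]) x) \<or> (a = Rgt \<and> prefix (w @ [Lft]) x)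
        \<longleftrightarrow> prefix (w @ [opp a]) x" for a w
      by (cases a) auto
    then show ?thesis by (auto simp: turns_def)
  qed
  then show ?thesis
    unfolding E_set_def using turn_first_iff_not_excluded[of _ s Rgt] by auto
qed

lemma z_index_less:
  assumes "u \<in> vertices T" "v \<in> vertices T" "turn_first Rgt u v"
  shows "z_index T u < z_index T v"
proof -
  have "E_set T u \<subseteq> E_set T v"
    using assms turn_first_trans unfolding E_set_eq by blast
  moreover have "v \<in> E_set T v" "v \<notin> E_set T u"
    using assms turn_first_trans[of Rgt u v u] turn_first_irrefl by (auto simp: E_set_eq)
  ultimately have "E_set T u \<subset> E_set T v" by blast
  moreover have "finite (E_set T v)" by (simp add: E_set_eq)
  ultimately show ?thesis by (simp add: z_index_def psubset_card_mono)
qed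

lemma precedes_iff_prec:
  assumes "u \<in> vertices T" "v \<in> vertices T"
  shows "precedes T u v \<longleftrightarrow> prec u v"
proof -
  have "z_index T u < z_index T v \<longleftrightarrow> turn_first Rgt u v"
    using z_index_less[OF assms] z_index_less[OF assms(2,1)] turn_first_total[of u v Rgt]
      turn_first_irrefl[of Rgt u] by (cases "u = v") auto
  then show ?thesis by (simp add: precedes_def prec_def turn_count_eq)
qed

text \<open>The vertices opening a new row (\<open>d = Lft\<close>) or column (\<open>d = Rgt\<close>) in \<open>A(T)\<close>.\<close>

definition heads :: "'a tree \<Rightarrow> dir \<Rightarrow> vertex set" where
  "heads T d = {v \<in> vertices T. v = [] \<or> last v = d}"

lemma strip_in_heads: "v \<in> vertices T \<Longrightarrow> strip (opp d) v \<in> heads T d"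
  using strip_last[of "opp d" v] by (auto simp: heads_def strip_in_vertices)

text \<open>An edge of direction \<open>d\<close> increases \<open>coord d\<close> and preserves \<open>coord (opp d)\<close>.\<close>

fun coord :: "dir \<Rightarrow> cell \<Rightarrow> nat" where
  "coord Lft = fst"
| "coord Rgt = snd"

lemma coord_eqI: "(\<And>d. coord d p = coord d q) \<Longrightarrow> p = q"
  using coord.simps by (metis prod_eq_iff)

section \<open>Coordinates in A(T) as ranks among the heads\<close>

definition rank :: "'a tree \<Rightarrow> dir \<Rightarrow> vertex \<Rightarrow> nat" where
  "rank T d h = card {u \<in> heads T d. prec u h}"

lemma rank_less: "g \<in> heads T d \<Longrightarrow> prec g h \<Longrightarrow> rank T d g < rank T d h"
  unfolding rank_def
proof (rule psubset_card_mono)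
  assume gh: "g \<in> heads T d" "prec g h"
  then have "{u \<in> heads T d. prec u g} \<subseteq> {u \<in> heads T d. prec u h}"
    using prec_trans by auto
  then show "{u \<in> heads T d. prec u g} \<subset> {u \<in> heads T d. prec u h}"
    using gh prec_irrefl by blast
qed (simp add: heads_def)

lemma rank_less_iff:
  assumes "g \<in> heads T d" "h \<in> heads T d"
  shows "rank T d g < rank T d h \<longleftrightarrow> prec g h"
  using rank_less[OF assms(1), of h] rank_less[OF assms(2), of g] prec_total[of g h]
  by (cases "g = h") auto

text \<open>A coordinate is fixed at the vertex opening the row or column and inherited along edges
  of direction \<open>opp d\<close>; \<open>strip (opp d)\<close> goes back to that vertex.\<close>

lemma coord_place:
  assumes "v \<in> vertices T"
  shows "coord d (place T v) = rank T d (strip (opp d) v)"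
  using assms
proof (induction v rule: rev_induct)
  case Nil
  then show ?case by (cases d) (auto simp: rank_def)
next
  case (snoc e v)
  then have v: "v \<in> vertices T" and IH: "coord d (place T v) = rank T d (strip (opp d) v)"
    using vertices_prefix by auto
  show ?case
  proof (cases "e = d")
    case True
    have "[] \<in> vertices T" using snoc.prems vertices_prefix[of "[]"] by simp
    \<comment> \<open>The root belongs to \<open>heads\<close> but not to \<open>edge_ends\<close>;
      it accounts for the \<open>+ 1\<close> in \<open>position\<close>.\<close>
    then have "{u \<in> heads T d. prec u (v @ [d])}
        = insert [] {u \<in> edge_ends T d. precedes T u (v @ [d])}"
      using snoc.prems True precedes_iff_prec[of _ T "v @ [d]"]
      by (auto simp: heads_def edge_ends_def)
    moreover have "[] \<notin> edge_ends T d" "finite (edge_ends T d)" by (auto simp: edge_ends_def)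
    ultimately have "rank T d (v @ [d]) = position T d (v @ [d])"
      by (simp add: rank_def position_def)
    then have "rank T d (strip (opp d) (v @ [e])) = position T d (v @ [d])"
      using True by simp
    then show ?thesis using True by (cases d) simp_all
  next
    case False
    then have "e = opp d" by (simp add: neq_iff_opp)
    then show ?thesis using IH by (cases d) auto
  qed
qed

text \<open>By monotonicity and downward closure, \<open>g\<close> maps the heads before
  \<open>h\<close> bijectively onto the numbers below \<open>g h\<close>. This will identify the
  coordinates in an arbitrary staircase drawing.\<close>

lemma strict_mono_eq_rank:
  assumes mono: "\<And>u v. u \<in> heads T d \<Longrightarrow> v \<in> heads T d \<Longrightarrow> prec u v \<Longrightarrow> g u < g v"
    and down: "\<And>h k. h \<in> heads T d \<Longrightarrow> k < g h \<Longrightarrow> k \<in> g ` heads T d"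
    and h: "h \<in> heads T d"
  shows "g h = rank T d h"
proof -
  have iff: "g u < g v \<longleftrightarrow> prec u v" if "u \<in> heads T d" "v \<in> heads T d" for u v
    using mono[OF that] mono[OF that(2,1)] prec_total[of u v] by (cases "u = v") auto
  have "g ` {u \<in> heads T d. prec u h} = {..<g h}"
    using iff[OF _ h] down[OF h] by (auto simp: image_iff) metis
  moreover have "inj_on g {u \<in> heads T d. prec u h}"
  proof (rule inj_onI)
    fix u v assume "u \<in> {u \<in> heads T d. prec u h}" "v \<in> {u \<in> heads T d. prec u h}" "g u = g v"
    then show "u = v" using iff[of u v] iff[of v u] prec_total[of u v] by auto
  qed
  ultimately show ?thesis
    unfolding rank_def using card_image[of g "{u \<in> heads T d. prec u h}"] by simp
qed

lemma rank_downward: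
  assumes "h \<in> heads T d" "k < rank T d h"
  shows "k \<in> rank T d ` heads T d"
proof -
  have fin: "finite (heads T d)" by (simp add: heads_def)
  have inj: "inj_on (rank T d) (heads T d)"
  proof (rule inj_onI)
    fix u v assume "u \<in> heads T d" "v \<in> heads T d" "rank T d u = rank T d v"
    then show "u = v" using rank_less[of u T d v] rank_less[of v T d u] prec_total[of u v] by auto
  qed
  have *: "rank T d g < card (heads T d)" if "g \<in> heads T d" for g
    unfolding rank_def using that prec_irrefl[of g] by (intro psubset_card_mono fin) blast
  have "rank T d ` heads T d = {..<card (heads T d)}"
    by (rule card_subset_eq) (use * in \<open>auto simp: card_image[OF inj]\<close>)
  then show ?thesis using assms *[OF assms(1)] by auto
qed

subsection \<open>Trees drawn on the grid\<close>

text \<open>For \<open>d = Rgt\<close> this looks along the row of \<open>p\<close>, for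
  \<open>d = Lft\<close> along its column. With the direction as a parameter, one argument serves
  rows and columns.\<close>

definition has_pred :: "cell set \<Rightarrow> dir \<Rightarrow> cell \<Rightarrow> bool" where
  "has_pred A d p \<longleftrightarrow> (\<exists>q\<in>A. coord (opp d) q = coord (opp d) p \<and> coord d q < coord d p)"

lemma child_in_iff:
  "child_in A d q p \<longleftrightarrow> q \<in> A \<and> p \<in> A \<and> coord (opp d) q = coord (opp d) p \<and> coord d q < coord d p
     \<and> \<not> (\<exists>r\<in>A. coord (opp d) r = coord (opp d) p \<and> coord d q < coord d r \<and> coord d r < coord d p)"
  by (cases d) auto

lemma non_ambiguous_tree_iff:
  "non_ambiguous_tree A \<longleftrightarrow> finite A \<and> (0, 0) \<in> A
     \<and> (\<forall>p\<in>A. p \<noteq> (0, 0) \<longrightarrow> (\<forall>d. has_pred A (opp d) p \<longleftrightarrow> \<not> has_pred A d p))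
     \<and> (\<forall>p\<in>A. \<forall>d. \<forall>k<coord d p. \<exists>q\<in>A. coord d q = k)"
  unfolding non_ambiguous_tree_def has_pred_def all_dir_iff[of _ Lft] by auto

text \<open>Contrapositive form of the two weak monotonicities: for \<open>d = Lft\<close> the cells
  compared are the leftmost cells of rows, for \<open>d = Rgt\<close> the topmost cells of
  columns.\<close>

definition staircase :: "cell set \<Rightarrow> bool" where
  "staircase A \<longleftrightarrow> non_ambiguous_tree A \<and>
     (\<forall>d. \<forall>p\<in>A. \<forall>q\<in>A. \<not> has_pred A (opp d) p \<longrightarrow> \<not> has_pred A (opp d) q \<longrightarrow>
        coord (opp d) p < coord (opp d) q \<longrightarrow> coord d p < coord d q)"

lemma coord_origin [simp]: "coord d (0, 0) = 0"
  by (cases d) auto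



lemma child_in_has_pred: "child_in A d q p \<Longrightarrow> has_pred A d p"
  by (auto simp: child_in_iff has_pred_def)

lemma has_pred_neq_origin: "has_pred A d p \<Longrightarrow> p \<noteq> (0, 0)"
  by (auto simp: has_pred_def)

lemma has_pred_opp_iff:
  "non_ambiguous_tree A \<Longrightarrow> p \<in> A \<Longrightarrow> p \<noteq> (0, 0) \<Longrightarrow> has_pred A (opp d) p \<longleftrightarrow> \<not> has_pred A d p"
  by (simp add: non_ambiguous_tree_iff)

lemma has_pred_unique:
  assumes "non_ambiguous_tree A" "p \<in> A" "has_pred A d p" "has_pred A e p"
  shows "d = e"
  using has_pred_opp_iff[OF assms(1,2) has_pred_neq_origin[OF assms(3)], of d] assms(3,4)
  by (cases "e = d") (auto simp: neq_iff_opp)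

lemma coord_eqI2: "coord d p = coord d q \<Longrightarrow> coord (opp d) p = coord (opp d) q \<Longrightarrow> p = q"
  by (cases d) (auto simp: prod_eq_iff)

lemma has_pred_imp_child_in:
  assumes "finite A" "p \<in> A" "has_pred A d p"
  shows "\<exists>q. child_in A d q p"
proof -
  let ?Q = "{q \<in> A. coord (opp d) q = coord (opp d) p \<and> coord d q < coord d p}"
  have Q: "finite ?Q" "?Q \<noteq> {}" using assms by (auto simp: has_pred_def)
  then have "Max (coord d ` ?Q) \<in> coord d ` ?Q" by (intro Max_in) auto
  then obtain q where q: "q \<in> ?Q" "coord d q = Max (coord d ` ?Q)" by auto
  have "coord d r \<le> coord d q" if "r \<in> ?Q" for r
    unfolding q(2) using Q(1) that by simp
  then have "child_in A d q p"
    using q(1) assms(2) unfolding child_in_iff by fastforce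
  then show ?thesis by blast
qed

lemma parent_unique:
  assumes "non_ambiguous_tree A" "child_in A d q p" "child_in A e r p"
  shows "d = e \<and> q = r"
proof -
  have "d = e"
    using has_pred_unique[OF assms(1) _ child_in_has_pred[OF assms(2)] child_in_has_pred[OF assms(3)]]
      assms(2) by (simp add: child_in_iff)
  moreover have "coord d q = coord d r"
    using assms(2,3) \<open>d = e\<close> unfolding child_in_iff by (metis linorder_neqE_nat)
  moreover have "coord (opp d) q = coord (opp d) r"
    using assms(2,3) \<open>d = e\<close> unfolding child_in_iff by metis
  ultimately show ?thesis using coord_eqI2 by blast
qed

lemma child_unique:
  assumes "child_in A d q p" "child_in A d q r"
  shows "p = r"
proof -
  have "coord d p = coord d r"
    using assms unfolding child_in_iff by (metis linorder_neqE_nat)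
  moreover have "coord (opp d) p = coord (opp d) r"
    using assms unfolding child_in_iff by metis
  ultimately show ?thesis using coord_eqI2 by blast
qed

lemma not_child_in_origin: "\<not> child_in A d q (0, 0)"
  by (simp add: child_in_iff)

section \<open>Uniqueness and existence of the underlying tree\<close>

definition tree_iso :: "'a tree \<Rightarrow> cell set \<Rightarrow> (vertex \<Rightarrow> cell) \<Rightarrow> bool" where
  "tree_iso T A f \<longleftrightarrow> bij_betw f (vertices T) A \<and> f [] = (0, 0)
     \<and> (\<forall>u\<in>vertices T. \<forall>v\<in>vertices T. \<forall>d. v = u @ [d] \<longleftrightarrow> child_in A d (f u) (f v))"

lemma is_underlying_tree_iff:
  "is_underlying_tree A T \<longleftrightarrow> non_ambiguous_tree A \<and> T \<in> binary_trees \<and> (\<exists>f. tree_iso T A f)"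
  by (simp add: is_underlying_tree_def tree_iso_def)

text \<open>It is enough to check the edges of \<open>T\<close>: parents in \<open>A\<close> are
  unique, so an edge of \<open>A\<close> into \<open>f v\<close> is the one coming from the parent
  of \<open>v\<close>.\<close>

lemma tree_isoI:
  assumes A: "non_ambiguous_tree A"
    and f: "bij_betw f (vertices T) A" "f [] = (0, 0)"
    and child: "\<And>u d. u @ [d] \<in> vertices T \<Longrightarrow> child_in A d (f u) (f (u @ [d]))"
  shows "tree_iso T A f"
proof -
  have "v = u @ [d]" if uv: "u \<in> vertices T" "v \<in> vertices T" and c: "child_in A d (f u) (f v)" for u v d
  proof (cases v rule: rev_cases)
    case Nil
    then show ?thesis using c f(2) not_child_in_origin by metis
  next
    case (snoc w e)
    then have "child_in A e (f w) (f v)" using child uv by auto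
    then have "d = e \<and> f u = f w" using A c parent_unique by blast
    moreover have "w \<in> vertices T" using uv snoc vertices_prefix by blast
    ultimately show ?thesis using f(1) uv snoc by (metis bij_betw_inv_into_left)
  qed
  then show ?thesis using f child unfolding tree_iso_def by blast
qed

lemma tree_iso_child: "tree_iso T A f \<Longrightarrow> u @ [d] \<in> vertices T \<Longrightarrow> child_in A d (f u) (f (u @ [d]))"
  unfolding tree_iso_def using vertices_prefix by blast

lemma vertices_inject: "vertices T = vertices U \<Longrightarrow> (T :: unit tree) = U"
proof (induction T arbitrary: U)
  case Leaf
  then show ?case by (cases U) auto
next
  case (Node l a r)
  then obtain l' a' r' where U: "U = Node l' a' r'" by (cases U) auto
  have "Lft # s \<in> vertices (Node l a r) \<longleftrightarrow> Lft # s \<in> vertices (Node l' a' r')"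
    "Rgt # s \<in> vertices (Node l a r) \<longleftrightarrow> Rgt # s \<in> vertices (Node l' a' r')" for s
    using Node.prems U by auto
  then have "vertices l = vertices l'" "vertices r = vertices r'" by (auto simp: image_iff)
  then show ?case using Node.IH U by simp
qed

text \<open>The cell of an address is found by walking in \<open>A\<close> from the origin, each
  step being determined by its direction. This walk refers to \<open>A\<close> only, not to the
  tree.\<close>

lemma tree_iso_same_vertices:
  assumes f: "tree_iso T A f" and g: "tree_iso U A g"
    and U: "[] \<in> vertices U"
  shows "v \<in> vertices T \<Longrightarrow> v \<in> vertices U \<and> f v = g v"
proof (induction v rule: rev_induct)
  case Nil
  then show ?case using f g U by (simp add: tree_iso_def)
next
  case (snoc d u)
  then have u: "u \<in> vertices U" "f u = g u" using vertices_prefix by blast+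
  have c: "child_in A d (f u) (f (u @ [d]))" using tree_iso_child[OF f] snoc.prems .
  then have "f (u @ [d]) \<in> A" by (simp add: child_in_iff)
  then obtain w where w: "w \<in> vertices U" "f (u @ [d]) = g w"
    using g unfolding tree_iso_def bij_betw_def by blast
  then have "w = u @ [d]" using g c u unfolding tree_iso_def by metis
  then show ?case using w by simp
qed

lemma underlying_tree_unique:
  assumes "is_underlying_tree A T" "is_underlying_tree A U"
  shows "T = U"
proof -
  obtain f g where "tree_iso T A f" "tree_iso U A g"
    using assms by (auto simp: is_underlying_tree_iff)
  moreover have "[] \<in> vertices T" "[] \<in> vertices U"
    using assms Nil_in_vertices by (auto simp: is_underlying_tree_iff)
  ultimately have "vertices T = vertices U"
    using tree_iso_same_vertices by blast
  then show ?thesis by (rule vertices_inject)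
qed

lemma underlying_tree_eq: "is_underlying_tree A T \<Longrightarrow> underlying_tree A = T"
  unfolding underlying_tree_def using underlying_tree_unique by (blast intro: the_equality)

text \<open>The two subtrees are built recursively from the words following a first letter
  \<open>Lft\<close> or \<open>Rgt\<close>; these sets are smaller because \<open>[]\<close> has no
  first letter.\<close>

lemma ex_tree_of_vertices:
  "finite V \<Longrightarrow> (\<And>u s. u @ s \<in> V \<Longrightarrow> u \<in> V) \<Longrightarrow> \<exists>T :: unit tree. vertices T = V"
proof (induction "card V" arbitrary: V rule: less_induct)
  case less
  show ?case
  proof (cases "V = {}")
    case True
    then show ?thesis by (intro exI[of _ Leaf]) simp
  next
    case False
    then have Nil: "[] \<in> V" using less.prems(2)[of "[]"] by auto
    have "\<exists>T :: unit tree. vertices T = {s. d # s \<in> V}" for d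
    proof (rule less.hyps)
      have inj: "inj ((#) d)" by (rule inj_onI) simp
      then show fin: "finite {s. d # s \<in> V}"
        using finite_vimageI[OF less.prems(1), of "(#) d"] by (simp add: vimage_def)
      have "(#) d ` {s. d # s \<in> V} \<subset> V" using Nil by auto
      then show "card {s. d # s \<in> V} < card V"
        using psubset_card_mono[OF less.prems(1)] card_image[OF inj_on_subset[OF inj]]
        by (metis subset_UNIV)
      show "u \<in> {s. d # s \<in> V}" if "u @ s \<in> {s. d # s \<in> V}" for u s
        using less.prems(2)[of "d # u" s] that by simp
    qed
    then obtain l r :: "unit tree" where
      "vertices l = {s. Lft # s \<in> V}" "vertices r = {s. Rgt # s \<in> V}" by metis
    moreover have "V = insert [] ((#) Lft ` {s. Lft # s \<in> V} \<union> (#) Rgt ` {s. Rgt # s \<in> V})"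
    proof (intro set_eqI iffI)
      fix v assume "v \<in> V"
      then show "v \<in> insert [] ((#) Lft ` {s. Lft # s \<in> V} \<union> (#) Rgt ` {s. Rgt # s \<in> V})"
        by (cases v; cases "hd v") auto
    qed (use Nil in auto)
    ultimately have "vertices (Node l () r) = V" by simp
    then show ?thesis by blast
  qed
qed

text \<open>The walk along child edges from the origin. It is functional because children are
  unique, injective because parents are, and it arrives at every cell of a non-ambiguous tree. So it
  is the graph of the desired isomorphism.\<close>

inductive reaches :: "cell set \<Rightarrow> vertex \<Rightarrow> cell \<Rightarrow> bool" for A where
  reaches_Nil: "reaches A [] (0, 0)"
| reaches_snoc: "reaches A u q \<Longrightarrow> child_in A d q p \<Longrightarrow> reaches A (u @ [d]) p"

lemma reaches_functional: "reaches A u p \<Longrightarrow> reaches A u q \<Longrightarrow> p = q"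
proof (induction arbitrary: q rule: reaches.induct)
  case reaches_Nil
  then show ?case by (auto elim: reaches.cases)
next
  case (reaches_snoc u q d p r)
  from reaches_snoc.prems obtain q' where "reaches A u q'" "child_in A d q' r"
    by (auto elim: reaches.cases)
  then show ?case using reaches_snoc.IH reaches_snoc.hyps child_unique by blast
qed

lemma reaches_inj:
  assumes A: "non_ambiguous_tree A"
  shows "reaches A u p \<Longrightarrow> reaches A v p \<Longrightarrow> u = v"
proof (induction arbitrary: v rule: reaches.induct)
  case reaches_Nil
  then show ?case using not_child_in_origin by (auto elim: reaches.cases)
next
  case (reaches_snoc u q d p)
  from reaches_snoc.prems show ?case
  proof cases
    case reaches_Nil
    then show ?thesis using reaches_snoc.hyps not_child_in_origin by metis
  next
    case (reaches_snoc w r e)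
    then have "d = e \<and> q = r"
      using parent_unique[OF A \<open>child_in A d q p\<close>] by blast
    then show ?thesis using reaches_snoc reaches_snoc.IH by blast
  qed
qed

lemma reaches_in: "non_ambiguous_tree A \<Longrightarrow> reaches A u p \<Longrightarrow> p \<in> A"
  by (erule reaches.cases) (auto simp: non_ambiguous_tree_def child_in_iff)

lemma reaches_prefix: "reaches A (u @ s) p \<Longrightarrow> \<exists>q. reaches A u q"
proof (induction s arbitrary: p rule: rev_induct)
  case (snoc e s)
  from snoc.prems show ?case
    by (cases rule: reaches.cases) (use snoc.IH in auto)
qed auto

lemma ex_reaches:
  assumes A: "non_ambiguous_tree A"
  shows "p \<in> A \<Longrightarrow> \<exists>u. reaches A u p"
proof (induction "coord Lft p + coord Rgt p" arbitrary: p rule: less_induct)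
  case less
  show ?case
  proof (cases "p = (0, 0)")
    case True
    then show ?thesis using reaches_Nil by blast
  next
    case False
    then obtain d where "has_pred A d p"
      using has_pred_opp_iff[OF A less.prems] by blast
    then obtain q where c: "child_in A d q p"
      using has_pred_imp_child_in[of A p d] A less.prems
      by (auto simp: non_ambiguous_tree_def)
    then have "coord Lft q + coord Rgt q < coord Lft p + coord Rgt p"
      by (cases d) auto
    then show ?thesis
      using less.hyps c reaches_snoc by (metis child_in_iff)
  qed
qed

text \<open>The addresses of the cells of \<open>A\<close> form a finite set closed under prefixes,
  hence are the vertices of a tree.\<close>

lemma ex_underlying_tree:
  assumes A: "non_ambiguous_tree A"
  shows "\<exists>T. is_underlying_tree A T"
proof -
  define V f where "V = {u. \<exists>p. reaches A u p}" and "f = (\<lambda>u. THE p. reaches A u p)"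
  have f: "f u = p" if "reaches A u p" for u p
    unfolding f_def using that reaches_functional[OF _ that] by (rule the_equality)
  have V: "reaches A u (f u)" if u: "u \<in> V" for u
  proof -
    obtain p where "reaches A u p" using u by (auto simp: V_def)
    then show ?thesis using f by simp
  qed
  have "bij_betw f V A"
  proof (rule bij_betwI')
    show "f u = f v \<longleftrightarrow> u = v" if "u \<in> V" "v \<in> V" for u v
      using reaches_inj[OF A V[OF that(1)], of v] V[OF that(2)] by auto
    show "f u \<in> A" if "u \<in> V" for u
      using reaches_in[OF A V[OF that]] .
    show "\<exists>u\<in>V. p = f u" if p: "p \<in> A" for p
    proof -
      obtain u where "reaches A u p" using ex_reaches[OF A p] by blast
      then have "u \<in> V" "p = f u" using f[of u p] unfolding V_def by blast+
      then show ?thesis by blast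
    qed
  qed
  moreover have "finite A" using A by (simp add: non_ambiguous_tree_def)
  ultimately have "finite V" using bij_betw_finite by blast
  moreover have "u \<in> V" if "u @ s \<in> V" for u s
    using that reaches_prefix unfolding V_def by blast
  ultimately obtain T :: "unit tree" where T: "vertices T = V"
    using ex_tree_of_vertices by blast
  have "tree_iso T A f"
  proof (rule tree_isoI[OF A])
    show "bij_betw f (vertices T) A" using T \<open>bij_betw f V A\<close> by simp
    show "f [] = (0, 0)" by (simp add: f reaches_Nil)
    fix u d assume "u @ [d] \<in> vertices T"
    then obtain p where p: "reaches A (u @ [d]) p" using T V_def by auto
    then obtain q where "reaches A u q" "child_in A d q p"
      by (auto elim: reaches.cases)
    then show "child_in A d (f u) (f (u @ [d]))" using f[OF p] f by simp
  qed
  moreover have "T \<in> binary_trees"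
  proof -
    have "[] \<in> vertices T" using T reaches_Nil[of A] unfolding V_def by blast
    then show ?thesis by (auto simp: binary_trees_def)
  qed
  ultimately show ?thesis using A is_underlying_tree_iff by blast
qed

section \<open>A staircase drawing is determined by the tree\<close>

lemma chain_strict_mono:
  assumes up: "\<And>u. u @ [d] \<in> V \<Longrightarrow> f u < (f (u @ [d]) :: nat)"
    and V: "\<And>u s. u @ s \<in> V \<Longrightarrow> u \<in> V"
  shows "u @ replicate (Suc i) d \<in> V \<Longrightarrow> f u < f (u @ replicate (Suc i) d)"
proof (induction i)
  case 0
  then show ?case using up by simp
next
  case (Suc i)
  have eq: "u @ replicate (Suc (Suc i)) d = (u @ replicate (Suc i) d) @ [d]"
    by (metis append.assoc replicate_append_same replicate_Suc)
  then have "f (u @ replicate (Suc i) d) < f (u @ replicate (Suc (Suc i)) d)"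
    using up Suc.prems by metis
  then show ?case using Suc eq V by (metis order.strict_trans)
qed

text \<open>Induction on the lengths, with alternating direction. If \<open>strip d g\<close>
  precedes \<open>strip d h\<close>, induction orders their \<open>opp d\<close> coordinates, which
  \<open>g\<close> and \<open>h\<close> inherit, and the staircase condition passes this on to
  \<open>coord d\<close>. If these tops agree, \<open>h\<close> lies below \<open>g\<close> in one
  chain. The reverse order of the tops is excluded by \<open>prec_strip_imp_prec\<close>.\<close>

lemma tree_iso_prec_coord:
  assumes A: "staircase A" and f: "tree_iso T A f"
  shows "g \<in> heads T d \<Longrightarrow> h \<in> heads T d \<Longrightarrow> prec g h \<Longrightarrow> coord d (f g) < coord d (f h)"
proof (induction "length g + length h" arbitrary: g h d rule: less_induct)
  case less
  have nat: "non_ambiguous_tree A" using A by (simp add: staircase_def)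
  have up: "coord d (f u) < coord d (f (u @ [d]))"
    and same: "coord (opp d) (f (u @ [d])) = coord (opp d) (f u)"
    if "u @ [d] \<in> vertices T" for u d
    using tree_iso_child[OF f that] by (auto simp: child_in_iff)
  have gh: "g \<in> vertices T" "h \<in> vertices T" using less.prems by (auto simp: heads_def)
  have "h \<noteq> []" using less.prems by auto
  then have "last h = d" using less.prems by (auto simp: heads_def)
  then obtain h' where h': "h = h' @ [d]" using \<open>h \<noteq> []\<close> by (metis append_butlast_last_id)
  show ?case
  proof (cases "g = []")
    case True
    then have "coord d (f g) = 0" using f by (simp add: tree_iso_def)
    then show ?thesis using up[of h' d] gh h' by simp
  next
    case False
    then have "last g = d" using less.prems by (auto simp: heads_def)
    then obtain g' where g': "g = g' @ [d]" using False by (metis append_butlast_last_id)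
    \<comment> \<open>A cell entered by a \<open>d\<close>-edge has no predecessor in the other
      direction, which makes the staircase condition applicable to \<open>f g\<close> and
      \<open>f h\<close>.\<close>
    have no: "\<not> has_pred A (opp d) (f v)" if "v = v' @ [d]" "v \<in> vertices T" for v v'
    proof -
      have "child_in A d (f v') (f v)" using tree_iso_child[OF f, of v' d] that by simp
      then have "has_pred A d (f v)" "f v \<in> A" by (auto simp: child_in_has_pred child_in_iff)
      then show ?thesis using has_pred_opp_iff[OF nat _ has_pred_neq_origin] by blast
    qed
    have st: "coord (opp d) (f v) = coord (opp d) (f (strip d v))" if "v \<in> vertices T" for v
      using that
    proof (induction v rule: rev_induct)
      case (snoc e v)
      then show ?case
        using same[of v d] vertices_prefix[of v "[e]" T] by (cases "e = d") (auto simp: strip_snoc)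
    qed simp
    consider "prec (strip d g) (strip d h)" | "strip d g = strip d h" | "prec (strip d h) (strip d g)"
      using prec_total by blast
    then show ?thesis
    proof cases
      case 1
      have "length (strip d g) < length g" "length (strip d h) < length h"
        using prefix_strip[of d g'] prefix_strip[of d h'] g' h'
        by (auto dest!: prefix_length_le)
      then have "coord (opp d) (f (strip d g)) < coord (opp d) (f (strip d h))"
        using less.hyps[of "strip d g" "strip d h" "opp d"] 1 gh strip_in_heads[of _ T "opp d"] by simp
      then show ?thesis
        using A no[OF g'] no[OF h'] st gh f unfolding staircase_def tree_iso_def bij_betw_def
        by (metis image_eqI)
    next
      case 2
      then show ?thesis
      proof (cases rule: strip_eq_cases)
        case (1 i)
        then have "prefix h g" by simp
        then show ?thesis
          using less.prems(3) strict_prefix_prec prec_trans prec_irrefl strict_prefix_def by metis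
      next
        case (2 i)
        then obtain j where "i = Suc j" using less.prems(3) by (cases i) auto
        then show ?thesis
          using 2 gh chain_strict_mono[of d "vertices T" "\<lambda>u. coord d (f u)" g j]
            up vertices_prefix by blast
      qed
    next
      case 3
      then have "prec h g"
        using prec_strip_imp_prec \<open>g \<noteq> []\<close> \<open>h \<noteq> []\<close> \<open>last g = d\<close> \<open>last h = d\<close> by blast
      then show ?thesis using less.prems(3) prec_trans prec_irrefl by blast
    qed
  qed
qed

lemma tree_iso_coord_strip:
  assumes f: "tree_iso T A f" and v: "v \<in> vertices T"
  shows "coord d (f v) = coord d (f (strip (opp d) v))"
  using v
proof (induction v rule: rev_induct)
  case (snoc e v)
  then show ?case
    using tree_iso_child[OF f, of v e] vertices_prefix[of v "[e]" T]
    by (cases "e = opp d") (auto simp: strip_snoc child_in_iff)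
qed simp

text \<open>On the heads, the coordinates of \<open>f\<close> increase strictly along
  \<open>prec\<close> and leave no gaps, so they are ranks, as are those of \<open>place\<close>.
  Other vertices inherit each coordinate from a head.\<close>

lemma tree_iso_staircase_eq_place:
  assumes A: "staircase A" and f: "tree_iso T A f" and v: "v \<in> vertices T"
  shows "f v = place T v"
proof (rule coord_eqI)
  fix d
  have "coord d (f h) = rank T d h" if "h \<in> heads T d" for h
  proof (rule strict_mono_eq_rank[where g = "\<lambda>v. coord d (f v)"])
    show "k \<in> (\<lambda>v. coord d (f v)) ` heads T d" if h: "h \<in> heads T d" and "k < coord d (f h)" for h k
    proof -
      have "f h \<in> A" using f h by (auto simp: tree_iso_def bij_betw_def heads_def)
      \<comment> \<open>Some cell of \<open>A\<close> has coordinate \<open>k\<close>; the vertex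
        opening its row or column is a head with the same coordinate.\<close>
      then obtain q where "q \<in> A" "coord d q = k"
        using A \<open>k < coord d (f h)\<close> unfolding staircase_def non_ambiguous_tree_iff by blast
      then obtain w where w: "w \<in> vertices T" "coord d (f w) = k"
        using f by (auto simp: tree_iso_def bij_betw_def)
      then show ?thesis
        using tree_iso_coord_strip[OF f w(1), of d] strip_in_heads[OF w(1)] by auto
    qed
  qed (use tree_iso_prec_coord[OF A f] that in auto)
  then show "coord d (f v) = coord d (place T v)"
    using tree_iso_coord_strip[OF f v] coord_place[OF v] strip_in_heads[OF v] by simp
qed

section \<open>The set A(T) is a staircase with underlying tree T\<close>

lemma coord_place_less_iff:
  assumes "u \<in> vertices T" "v \<in> vertices T"
  shows "coord d (place T u) < coord d (place T v) \<longleftrightarrow> prec (strip (opp d) u) (strip (opp d) v)"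
  using assms by (simp add: coord_place rank_less_iff strip_in_heads)

lemma coord_place_eq_iff:
  assumes "u \<in> vertices T" "v \<in> vertices T"
  shows "coord d (place T u) = coord d (place T v) \<longleftrightarrow> strip (opp d) u = strip (opp d) v"
  using coord_place_less_iff[of _ T _ d] assms prec_total prec_irrefl
  by (metis linorder_neqE_nat order_less_irrefl)

lemma coord_place_snoc:
  assumes "u @ [d] \<in> vertices T"
  shows "coord d (place T u) < coord d (place T (u @ [d]))"
    and "coord (opp d) (place T (u @ [d])) = coord (opp d) (place T u)"
proof -
  have u: "u \<in> vertices T" using assms vertices_prefix by blast
  have "strict_prefix (strip (opp d) u) (u @ [d])"
    by (rule prefix_order.le_less_trans[OF prefix_strip]) (simp add: strict_prefix_def)
  then show "coord d (place T u) < coord d (place T (u @ [d]))"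
    using strict_prefix_prec by (simp add: coord_place_less_iff u assms)
  show "coord (opp d) (place T (u @ [d])) = coord (opp d) (place T u)"
    by (simp add: coord_place_eq_iff u assms)
qed

lemma coord_place_chain:
  assumes "u @ replicate i d \<in> vertices T"
  shows "coord d (place T u) \<le> coord d (place T (u @ replicate i d))"
proof (cases i)
  case (Suc j)
  then show ?thesis
    using chain_strict_mono[of d "vertices T" "\<lambda>u. coord d (place T u)" u j]
      coord_place_snoc(1) vertices_prefix assms by (metis order_less_imp_le)
qed simp

lemma inj_on_place: "inj_on (place T) (vertices T)"
proof (rule inj_onI)
  fix u v assume "u \<in> vertices T" "v \<in> vertices T" "place T u = place T v"
  then have "strip (opp d) u = strip (opp d) v" for d
    using coord_place_eq_iff by metis
  then show "u = v" by (metis opp_opp strip_strip_eqD)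
qed

text \<open>For the second claim: a vertex with the same coordinate \<open>d\<close> as
  \<open>u @ [d]\<close> lies in the chain of \<open>opp d\<close> edges hanging from it, so its
  other coordinate is not smaller.\<close>

lemma place_has_pred:
  assumes "u @ [d] \<in> vertices T"
  shows "has_pred (place_tree T) d (place T (u @ [d]))"
    and "\<not> has_pred (place_tree T) (opp d) (place T (u @ [d]))"
proof -
  have u: "u \<in> vertices T" using assms vertices_prefix by blast
  then show "has_pred (place_tree T) d (place T (u @ [d]))"
    unfolding has_pred_def place_tree_def using coord_place_snoc[OF assms] by auto
  show "\<not> has_pred (place_tree T) (opp d) (place T (u @ [d]))"
  proof
    assume "has_pred (place_tree T) (opp d) (place T (u @ [d]))"
    then obtain w where w: "w \<in> vertices T" "coord d (place T w) = coord d (place T (u @ [d]))"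
      "coord (opp d) (place T w) < coord (opp d) (place T (u @ [d]))"
      by (auto simp: has_pred_def place_tree_def)
    then have "strip (opp d) w = u @ [d]"
      using coord_place_eq_iff[OF w(1) assms] by simp
    then obtain i where "w = (u @ [d]) @ replicate i (opp d)" using strip_decomp by metis
    then show False using coord_place_chain[of "u @ [d]" i "opp d" T] w by simp
  qed
qed

lemma place_Nil: "place T [] = (0, 0)" by simp

lemma not_has_pred_place_imp_heads:
  assumes "v \<in> vertices T" "\<not> has_pred (place_tree T) (opp d) (place T v)"
  shows "v \<in> heads T d"
proof (cases v rule: rev_cases)
  case (snoc u e)
  then have "e = d" using assms place_has_pred(1)[of u "opp d" T] neq_iff_opp by blast
  then show ?thesis using assms snoc by (simp add: heads_def)
qed (use assms in \<open>simp add: heads_def\<close>)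

lemma non_ambiguous_place_tree:
  assumes "T \<in> binary_trees"
  shows "non_ambiguous_tree (place_tree T)"
  unfolding non_ambiguous_tree_iff
proof (intro conjI ballI impI allI)
  show "finite (place_tree T)" by (simp add: place_tree_def)
  show "(0, 0) \<in> place_tree T"
    unfolding place_tree_def using Nil_in_vertices[OF assms] place_Nil by (metis imageI)
next
  fix p d assume p: "p \<in> place_tree T" "p \<noteq> (0, 0)"
  then obtain v where v: "v \<in> vertices T" "p = place T v" by (auto simp: place_tree_def)
  then obtain u e where "v = u @ [e]" using p(2) by (cases v rule: rev_cases) auto
  then show "has_pred (place_tree T) (opp d) p \<longleftrightarrow> \<not> has_pred (place_tree T) d p"
    using place_has_pred[of u e T] v by (cases "e = d") (auto simp: neq_iff_opp)
next
  fix p d k assume p: "p \<in> place_tree T" "k < coord d p"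
  then obtain v where v: "v \<in> vertices T" "p = place T v" by (auto simp: place_tree_def)
  then have "k < rank T d (strip (opp d) v)" using p coord_place by metis
  then obtain h where h: "h \<in> heads T d" "k = rank T d h"
    using rank_downward strip_in_heads v by blast
  then have "h \<in> vertices T" "strip (opp d) h = h"
    using strip_eq_self by (auto simp: heads_def)
  then show "\<exists>q\<in>place_tree T. coord d q = k"
    using coord_place[of h T d] h by (auto simp: place_tree_def)
qed

text \<open>Read through ranks, the staircase condition is \<open>prec_strip_imp_prec\<close>: the
  cells concerned are heads, \<open>coord (opp d)\<close> compares the tops of their chains, and
  \<open>coord d\<close> compares the heads themselves. The root is treated apart, being a head that
  ends no edge.\<close>

lemma staircase_place_tree:
  assumes "T \<in> binary_trees"
  shows "staircase (place_tree T)"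
  unfolding staircase_def
proof (intro conjI allI ballI impI)
  show "non_ambiguous_tree (place_tree T)" using assms by (rule non_ambiguous_place_tree)
  fix d p q
  assume "p \<in> place_tree T" "q \<in> place_tree T"
    and np: "\<not> has_pred (place_tree T) (opp d) p" "\<not> has_pred (place_tree T) (opp d) q"
    and less: "coord (opp d) p < coord (opp d) q"
  then obtain u v where u: "u \<in> vertices T" "p = place T u" and v: "v \<in> vertices T" "q = place T v"
    by (auto simp: place_tree_def)
  then have h: "u \<in> heads T d" "v \<in> heads T d"
    using not_has_pred_place_imp_heads np by auto
  have s: "prec (strip d u) (strip d v)"
    using coord_place_less_iff[OF u(1) v(1), of "opp d"] less u v by simp
  then have "v \<noteq> []" by auto
  moreover have "prec u v"
  proof (cases "u = []")
    case False
    then show ?thesis using prec_strip_imp_prec[OF _ _ _ _ s] h \<open>v \<noteq> []\<close> by (auto simp: heads_def)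
  qed (use \<open>v \<noteq> []\<close> in auto)
  moreover have "strip (opp d) u = u" "strip (opp d) v = v"
    using h strip_eq_self by (auto simp: heads_def)
  ultimately show "coord d p < coord d q"
    using coord_place_less_iff[OF u(1) v(1), of d] u v by simp
qed

lemma is_underlying_tree_place_tree:
  assumes "T \<in> binary_trees"
  shows "is_underlying_tree (place_tree T) T"
proof -
  have nat: "non_ambiguous_tree (place_tree T)" using assms by (rule non_ambiguous_place_tree)
  have "tree_iso T (place_tree T) (place T)"
  proof (rule tree_isoI[OF nat])
    show "bij_betw (place T) (vertices T) (place_tree T)"
      using inj_on_place by (auto simp: place_tree_def bij_betw_def)
    fix u d assume ud: "u @ [d] \<in> vertices T"
    have u: "u \<in> vertices T" using ud vertices_prefix by blast
    \<comment> \<open>A cell between parent and child would lie in the same chain of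
      \<open>d\<close>-edges, hence at or above \<open>u\<close>, or at or below
      \<open>u @ [d]\<close>.\<close>
    have "False" if w: "w \<in> vertices T" "coord (opp d) (place T w) = coord (opp d) (place T u)"
      and between: "coord d (place T u) < coord d (place T w)"
        "coord d (place T w) < coord d (place T (u @ [d]))" for w
    proof -
      have "strip d w = strip d u"
        using coord_place_eq_iff[OF w(1) u] w(2) by simp
      then show False
      proof (cases rule: strip_eq_cases)
        case (1 i)
        show False
        proof (cases i)
          case 0
          then show ?thesis using 1 between by simp
        next
          case (Suc j)
          then have "w = (u @ [d]) @ replicate j d" using 1 by simp
          then show ?thesis using coord_place_chain[of "u @ [d]" j d T] w between by simp
        qed
      next
        case (2 i)
        then show False using coord_place_chain[of w i d T] u between by simp
      qed
    qed
    then show "child_in (place_tree T) d (place T u) (place T (u @ [d]))"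
      unfolding child_in_iff using u ud coord_place_snoc[OF ud]
      by (auto simp: place_tree_def simp del: place.simps)
  qed simp
  then show ?thesis using assms nat is_underlying_tree_iff by blast
qed

subsection \<open>Parallelogram polyominoes\<close>

definition rows_between :: "nat \<Rightarrow> (nat \<Rightarrow> nat) \<Rightarrow> (nat \<Rightarrow> nat) \<Rightarrow> cell set" where
  "rows_between m l r = {(x, y). x < m \<and> l x \<le> y \<and> y < r x}"

text \<open>Row \<open>x\<close> is the half-open interval from \<open>l x\<close> to
  \<open>r x\<close>. The last condition makes consecutive rows overlap; for the boundary paths it
  means that they do not meet between their ends.\<close>

definition row_profile :: "nat \<Rightarrow> (nat \<Rightarrow> nat) \<Rightarrow> (nat \<Rightarrow> nat) \<Rightarrow> bool" where
  "row_profile m l r \<longleftrightarrow> m > 0 \<and> l 0 = 0 \<and> (\<forall>x<m. l x < r x)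
     \<and> (\<forall>x x'. x \<le> x' \<longrightarrow> x' < m \<longrightarrow> l x \<le> l x' \<and> r x \<le> r x')
     \<and> (\<forall>x. Suc x < m \<longrightarrow> l (Suc x) < r x)"

text \<open>\<open>h x\<close> is the number of south-east steps before the \<open>x\<close>-th south-west step (counted from \<open>0\<close>),
  continued by \<open>h x = N\<close> for \<open>x \<ge> m\<close> so that the last points of the path need no special case.\<close>

definition step_heights :: "step list \<Rightarrow> nat \<Rightarrow> nat \<Rightarrow> (nat \<Rightarrow> nat) \<Rightarrow> bool" where
  "step_heights w m N h \<longleftrightarrow> endpoint w = (m, N) \<and> mono h \<and> (\<forall>x\<ge>m. h x = N)
     \<and> (\<forall>x a. has_sw_step_at w (x, a) \<longleftrightarrow> x < m \<and> a = h x)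
     \<and> path_points w = {(x, y). x \<le> m \<and> y \<le> h x \<and> (x > 0 \<longrightarrow> h (x - 1) \<le> y)}"

section \<open>Lattice paths, and polyominoes described by their rows\<close>

lemma endpoint_snoc:
  "endpoint (w @ [SW]) = (Suc (fst (endpoint w)), snd (endpoint w))"
  "endpoint (w @ [SE]) = (fst (endpoint w), Suc (snd (endpoint w)))"
  by (simp_all add: endpoint_def)

lemma path_points_snoc: "path_points (w @ [s]) = insert (endpoint (w @ [s])) (path_points w)"
proof -
  have "path_points (w @ [s]) = (\<lambda>i. endpoint (take i (w @ [s]))) ` {..Suc (length w)}"
    by (auto simp: path_points_def)
  also have "\<dots> = insert (endpoint (w @ [s])) ((\<lambda>i. endpoint (take i w)) ` {..length w})"
    by (auto simp: atMost_Suc)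
  finally show ?thesis by (auto simp: path_points_def)
qed

lemma has_sw_step_at_snoc:
  "has_sw_step_at (w @ [s]) p \<longleftrightarrow> has_sw_step_at w p \<or> (s = SW \<and> p = endpoint w)"
proof -
  have "has_sw_step_at (w @ [s]) p \<longleftrightarrow>
      (\<exists>i<length w. (w @ [s]) ! i = SW \<and> endpoint (take i (w @ [s])) = p) \<or>
      ((w @ [s]) ! length w = SW \<and> endpoint (take (length w) (w @ [s])) = p)"
    unfolding has_sw_step_at_def length_append_singleton Ex_less_Suc by blast
  also have "\<dots> \<longleftrightarrow> has_sw_step_at w p \<or> (s = SW \<and> p = endpoint w)"
    unfolding has_sw_step_at_def by (simp add: nth_append cong: conj_cong) metis
  finally show ?thesis .
qed

lemma step_heights_Nil: "step_heights [] 0 0 (\<lambda>_. 0)"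
  by (auto simp: step_heights_def endpoint_def has_sw_step_at_def path_points_def mono_def)

lemma step_heights_SW:
  assumes "step_heights w m N h"
  shows "step_heights (w @ [SW]) (Suc m) N h"
proof -
  have w: "endpoint w = (m, N)" "mono h" "\<And>x. x \<ge> m \<Longrightarrow> h x = N"
    "\<And>x a. has_sw_step_at w (x, a) \<longleftrightarrow> x < m \<and> a = h x"
    "path_points w = {(x, y). x \<le> m \<and> y \<le> h x \<and> (x > 0 \<longrightarrow> h (x - 1) \<le> y)}"
    using assms by (auto simp: step_heights_def)
  show ?thesis
    unfolding step_heights_def path_points_snoc has_sw_step_at_snoc endpoint_snoc w
    using w(2,3) by (auto simp: less_Suc_eq le_Suc_eq)
qed

lemma step_heights_SE:
  assumes "step_heights w m N h"
  shows "step_heights (w @ [SE]) m (Suc N) (\<lambda>x. if x < m then h x else Suc N)"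
proof -
  have w: "endpoint w = (m, N)" "mono h" "\<And>x. x \<ge> m \<Longrightarrow> h x = N"
    "\<And>x a. has_sw_step_at w (x, a) \<longleftrightarrow> x < m \<and> a = h x"
    "path_points w = {(x, y). x \<le> m \<and> y \<le> h x \<and> (x > 0 \<longrightarrow> h (x - 1) \<le> y)}"
    using assms by (auto simp: step_heights_def)
  have le: "h x \<le> N" for x     using monoD[OF w(2), of x "max x m"] w(3)[of "max x m"] by simp
  have "h x \<le> h y" if "x \<le> y" for x y using w(2) that by (auto simp: mono_def)
  then show ?thesis
    unfolding step_heights_def path_points_snoc has_sw_step_at_snoc endpoint_snoc w
    using w(3) le by (auto simp: mono_def le_Suc_eq not_less split: if_splits)
qed

lemma ex_step_heights: "\<exists>h. step_heights w (fst (endpoint w)) (snd (endpoint w)) h"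
proof (induction w rule: rev_induct)
  case Nil
  then show ?case using step_heights_Nil by (auto simp: endpoint_def)
next
  case (snoc s w)
  then show ?case
    using step_heights_SW step_heights_SE by (cases s) (fastforce simp: endpoint_snoc)+
qed

text \<open>Peel off the last step: south-west if the last south-west step is at the final height
  \<open>N\<close>, south-east otherwise.\<close>

lemma ex_path_with_heights:
  "mono h \<Longrightarrow> (\<And>x. x \<ge> m \<Longrightarrow> h x = N) \<Longrightarrow> \<exists>w. step_heights w m N h"
proof (induction "m + N" arbitrary: m N h rule: less_induct)
  case less
  have mono: "h x \<le> h y" if "x \<le> y" for x y using less.prems(1) that by (auto simp: mono_def)
  consider "m = 0" "N = 0" | m' where "m = Suc m'" "h m' = N" | N' where "N = Suc N'" "\<forall>x<m. h x \<le> N'"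
  proof (cases m)
    case 0
    then show ?thesis using that by (cases N) auto
  next
    case (Suc m')
    show ?thesis
    proof (cases "h m' = N")
      case False
      then have "h m' < N" using mono[of m' m] less.prems(2)[of m] Suc by simp
      then obtain N' where N': "N = Suc N'" "h m' \<le> N'" by (cases N) auto
      then have "\<forall>x<m. h x \<le> N'" using mono[of _ m'] Suc by (meson le_trans less_Suc_eq_le)
      then show ?thesis using that N' by blast
    qed (use Suc that in auto)
  qed
  then show ?case
  proof cases
    case 1
    then have "h = (\<lambda>_. 0)" using less.prems(2) by auto
    then show ?thesis using 1 step_heights_Nil by blast
  next
    case 2
    then have "h x = N" if "x \<ge> m'" for x
      using that less.prems(2) by (metis le_less_Suc_eq not_le)
    then obtain w where "step_heights w m' N h"
      using less.hyps[of m' N h] less.prems(1) 2 by auto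
    then show ?thesis using step_heights_SW 2 by blast
  next
    case 3
    \<comment> \<open>Before \<open>m\<close> all values are at most \<open>N'\<close>, so the
      minimum only lowers the constant continuation from \<open>N\<close> to
      \<open>N'\<close>.\<close>
    let ?h = "\<lambda>x. min (h x) N'"
    have "mono ?h" using mono by (auto simp: mono_def min_le_iff_disj)
    moreover have "?h x = N'" if "x \<ge> m" for x using that less.prems(2) 3 by simp
    ultimately obtain w where "step_heights w m N' ?h"
      using less.hyps[of m N' ?h] 3 by auto
    then have "step_heights (w @ [SE]) m N (\<lambda>x. if x < m then ?h x else N)"
      using step_heights_SE 3 by blast
    moreover have "(\<lambda>x. if x < m then ?h x else N) = h"
      using 3 less.prems(2) by (auto simp: fun_eq_iff min_def)
    ultimately show ?thesis by metis
  qed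
qed

lemma length_eq_endpoint: "length w = fst (endpoint w) + snd (endpoint w)"
proof (induction w)
  case (Cons s w)
  then show ?case by (cases s) (auto simp: endpoint_def)
qed (simp add: endpoint_def)

lemma rows_between_in_polyominoes:
  assumes "row_profile m l r"
  shows "rows_between m l r \<in> parallelogram_polyominoes"
proof -
  have p: "m > 0" "l 0 = 0" "\<And>x. x < m \<Longrightarrow> l x < r x"
    "\<And>x x'. x \<le> x' \<Longrightarrow> x' < m \<Longrightarrow> l x \<le> l x'" "\<And>x x'. x \<le> x' \<Longrightarrow> x' < m \<Longrightarrow> r x \<le> r x'"
    "\<And>x. Suc x < m \<Longrightarrow> l (Suc x) < r x"
    using assms unfolding row_profile_def by blast+
  \<comment> \<open>The right path ends with its south-west step in row \<open>m - 1\<close>, so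
    this is the height of the common end point.\<close>
  define N where "N = r (m - 1)"
  define L R where "L = (\<lambda>x. if x < m then l x else N)" and "R = (\<lambda>x. if x < m then r x else N)"
  have N: "r x \<le> N" if "x < m" for x using p(5)[of x "m - 1"] that p(1) by (simp add: N_def)
  have "N > 0" using N[of 0] p(1,2) p(3)[of 0] by simp
  have "mono L" "mono R"
    unfolding L_def R_def mono_def using p(3,4,5) N by (fastforce intro: order.trans less_imp_le)+
  then obtain u v where u: "step_heights u m N L" and v: "step_heights v m N R"
    using ex_path_with_heights[of L m N] ex_path_with_heights[of R m N] by (auto simp: L_def R_def)
  have "bounding_paths (m + N - 1) u v"
    unfolding bounding_paths_def
  proof (intro conjI)
    show "m + N - 1 \<ge> 1" using p(1) \<open>N > 0\<close> by simp
    show "length u = m + N - 1 + 1" "length v = m + N - 1 + 1" "endpoint u = endpoint v"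
      using u v p(1) by (auto simp: length_eq_endpoint step_heights_def)
    \<comment> \<open>At a common point with \<open>x > 0\<close>, \<open>y\<close> is at least
      \<open>R (x - 1)\<close> and at most \<open>L x\<close>; for \<open>x < m\<close> this
      contradicts the overlap of consecutive rows.\<close>
    have "(x = 0 \<and> y = 0) \<or> (x = m \<and> y = N)"
      if "x \<le> m" "y \<le> L x" "x > 0 \<longrightarrow> R (x - 1) \<le> y" for x y
    proof (cases x)
      case 0
      then show ?thesis using that p(1,2) by (simp add: L_def)
    next
      case (Suc x')
      show ?thesis
      proof (cases "x = m")
        case True
        then show ?thesis using that Suc by (auto simp: L_def R_def N_def split: if_splits)
      next
        case False
        then have "L x < R x'" using that Suc p(6)[of x'] by (simp add: L_def R_def)
        then show ?thesis using that Suc by simp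
      qed
    qed
    moreover have "L (m - 1) \<le> N" "R (m - 1) \<le> N" "L m = N" "R m = N" "L 0 = 0"
      using p(1,2) p(3)[of "m - 1"] by (auto simp: L_def R_def N_def)
    ultimately show "path_points u \<inter> path_points v = {(0, 0), endpoint u}"
      using u v p(1) by (auto simp: step_heights_def)
  qed
  moreover have "enclosed_boxes u v = rows_between m l r"
  proof -
    have "min (L x) (R x) = l x" "max (L x) (R x) = r x" if "x < m" for x
      using that p(3)[of x] by (auto simp: L_def R_def)
    then show ?thesis
      using u v by (auto simp: enclosed_boxes_def rows_between_def step_heights_def)
  qed
  ultimately show ?thesis unfolding parallelogram_polyominoes_def by blast
qed

lemma enclosed_boxes_commute: "enclosed_boxes u v = enclosed_boxes v u"
proof -
  have "enclosed_boxes u v \<subseteq> enclosed_boxes v u" for u v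
    unfolding enclosed_boxes_def by (force simp: min.commute max.commute)
  then show ?thesis by blast
qed

text \<open>If both paths began with a south-east step they would meet at \<open>(0, 1)\<close>. One
  that begins with a south-west step is taken as left boundary, and as the paths do not meet it
  stays strictly to the left in every row.\<close>

lemma polyomino_imp_rows_between:
  assumes "P \<in> parallelogram_polyominoes"
  obtains m l r where "row_profile m l r" "P = rows_between m l r"
proof -
  obtain n u v where b: "bounding_paths n u v" and P: "P = enclosed_boxes u v"
    using assms by (auto simp: parallelogram_polyominoes_def)
  obtain m N where e: "endpoint u = (m, N)" "endpoint v = (m, N)" and n: "m + N \<ge> 2"
    using b by (cases "endpoint u") (auto simp: bounding_paths_def length_eq_endpoint)
  obtain hu hv where hu: "step_heights u m N hu" and hv: "step_heights v m N hv"
    using ex_step_heights[of u] ex_step_heights[of v] e by auto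
  have meet: "(x = 0 \<and> y = 0) \<or> (x = m \<and> y = N)"
    if "x \<le> m" "y \<le> hu x" "y \<le> hv x" "x > 0 \<longrightarrow> hu (x - 1) \<le> y" "x > 0 \<longrightarrow> hv (x - 1) \<le> y" for x y
  proof -
    have "(x, y) \<in> path_points u" "(x, y) \<in> path_points v"
      using hu hv that unfolding step_heights_def by blast+
    then have "(x, y) \<in> {(0, 0), endpoint u}" using b unfolding bounding_paths_def by blast
    then show ?thesis using e by simp
  qed
  have zero: "hu 0 = 0 \<or> hv 0 = 0"
  proof (rule ccontr)
    assume "\<not> (hu 0 = 0 \<or> hv 0 = 0)"
    then have "hu 0 > 0" "hv 0 > 0" by auto
    then have "m = 0 \<and> N = 1" using meet[of 0 1] by force
    then show False using n by simp
  qed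
  have ordered: "row_profile m l r \<and> P = rows_between m l r"
    if u': "step_heights u' m N l" and v': "step_heights v' m N r" and l0: "l 0 = 0"
      and P': "P = enclosed_boxes u' v'"
      and meet: "\<And>x y. x \<le> m \<Longrightarrow> y \<le> l x \<Longrightarrow> y \<le> r x \<Longrightarrow> x > 0 \<longrightarrow> l (x - 1) \<le> y
        \<Longrightarrow> x > 0 \<longrightarrow> r (x - 1) \<le> y \<Longrightarrow> (x = 0 \<and> y = 0) \<or> (x = m \<and> y = N)" for u' v' l r
  proof (intro conjI)
    have mono: "x \<le> x' \<Longrightarrow> l x \<le> l x'" "x \<le> x' \<Longrightarrow> r x \<le> r x'" for x x'
      using u' v' by (auto simp: step_heights_def mono_def)
    have "m > 0"
      using u' l0 n by (cases m) (auto simp: step_heights_def)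
    \<comment> \<open>Otherwise the point \<open>(Suc x, r x)\<close> would lie on both paths
      without being an end point.\<close>
    have step: "l (Suc x) < r x" if "Suc x < m" "l x < r x" for x
      using meet[of "Suc x" "r x"] mono(2)[of x "Suc x"] that by force
    have less: "l x < r x" if "x < m" for x
      using that
    proof (induction x)
      case 0
      \<comment> \<open>If \<open>r 0 = 0\<close>, the paths would share \<open>(1, 0)\<close>,
        which is an end point only for \<open>m = 1\<close> and \<open>N = 0\<close>, contrary to
        \<open>m + N \<ge> 2\<close>.\<close>
      then show ?case using meet[of 1 0] l0 n by force
    next
      case (Suc x)
      then show ?case using step[of x] mono(2)[of x "Suc x"] by simp
    qed
    then show "row_profile m l r"
      unfolding row_profile_def using \<open>m > 0\<close> l0 mono step by auto
    have "min (l x) (r x) = l x" "max (l x) (r x) = r x" if "x < m" for x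
      using less[OF that] by auto
    then show "P = rows_between m l r"
      using u' v' P' by (auto simp: enclosed_boxes_def rows_between_def step_heights_def)
  qed
  from zero show thesis
  proof
    assume "hu 0 = 0"
    then show thesis using ordered[OF hu hv _ P meet] that by blast
  next
    assume "hv 0 = 0"
    moreover have "P = enclosed_boxes v u" using P enclosed_boxes_commute by simp
    ultimately show thesis using ordered[OF hv hu _ _ meet] that by blast
  qed
qed

section \<open>The border boxes of a polyomino\<close>

locale row_shape =
  fixes m :: nat and l r :: "nat \<Rightarrow> nat"
  assumes profile: "row_profile m l r"
begin

lemma rows: "m > 0" "l 0 = 0" "x < m \<Longrightarrow> l x < r x"
    "x \<le> x' \<Longrightarrow> x' < m \<Longrightarrow> l x \<le> l x'" "x \<le> x' \<Longrightarrow> x' < m \<Longrightarrow> r x \<le> r x'"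
    "Suc x < m \<Longrightarrow> l (Suc x) < r x"
  using profile unfolding row_profile_def by blast+

definition boxes where "boxes = rows_between m l r"

lemma boxes_iff: "(x, y) \<in> boxes \<longleftrightarrow> x < m \<and> l x \<le> y \<and> y < r x"
  by (simp add: boxes_def rows_between_def)

lemma border_iff:
  "(x, y) \<in> border_boxes boxes \<longleftrightarrow> (x, y) \<in> boxes \<and> (y = l x \<or> (\<forall>x'<x. (x', y) \<notin> boxes))"
proof -
  have "(\<forall>y'. (x, y') \<in> boxes \<longrightarrow> y \<le> y') \<longleftrightarrow> y = l x" if "(x, y) \<in> boxes"
    using that rows(3)[of x] by (auto simp: boxes_iff)
  moreover have "(\<forall>x'. (x', y) \<in> boxes \<longrightarrow> x \<le> x') \<longleftrightarrow> (\<forall>x'<x. (x', y) \<notin> boxes)"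
    by (meson not_le)
  ultimately show ?thesis unfolding border_boxes_def by blast
qed

lemma row_min_in_border: "x < m \<Longrightarrow> (x, l x) \<in> border_boxes boxes"
  using rows(3) by (simp add: border_iff boxes_iff)

lemma column_min_in_border:
  assumes "(x, y) \<in> boxes"
  obtains x' where "x' \<le> x" "(x', y) \<in> border_boxes boxes" "\<forall>x''<x'. (x'', y) \<notin> boxes"
proof -
  define x' where "x' = (LEAST x. (x, y) \<in> boxes)"
  have "(x', y) \<in> boxes" "x' \<le> x" "\<forall>x''<x'. (x'', y) \<notin> boxes"
    unfolding x'_def using assms LeastI Least_le not_less_Least by metis+
  then show thesis using that border_iff by blast
qed

lemma has_pred_border_Rgt:
  assumes "(x, y) \<in> border_boxes boxes"
  shows "has_pred (border_boxes boxes) Rgt (x, y) \<longleftrightarrow> l x < y"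
proof
  assume "l x < y"
  moreover have "(x, l x) \<in> border_boxes boxes"
    using assms row_min_in_border[of x] by (simp add: border_iff boxes_iff)
  ultimately show "has_pred (border_boxes boxes) Rgt (x, y)" by (force simp: has_pred_def)
qed (auto simp: has_pred_def border_iff boxes_iff)

lemma has_pred_border_Lft:
  "has_pred (border_boxes boxes) Lft (x, y) \<longleftrightarrow> (\<exists>x'<x. (x', y) \<in> boxes)"
proof
  assume "\<exists>x'<x. (x', y) \<in> boxes"
  then obtain x' where "x' < x" and x': "(x', y) \<in> boxes" by blast
  obtain x'' where "x'' \<le> x'" "(x'', y) \<in> border_boxes boxes" using column_min_in_border[OF x'] .
  then show "has_pred (border_boxes boxes) Lft (x, y)"
    unfolding has_pred_def using \<open>x' < x\<close> by (intro bexI[of _ "(x'', y)"]) auto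
qed (auto simp: has_pred_def border_iff)

text \<open>In the first row \<open>x'\<close> whose right end exceeds \<open>y\<close>, the left
  end is at most \<open>y\<close>: if there is a row before it, that row ends at or before
  \<open>y\<close> and overlaps row \<open>x'\<close>.\<close>

lemma ex_in_column:
  assumes "x < m" "y < r x"
  shows "\<exists>x'. (x', y) \<in> boxes"
proof -
  define x' where "x' = (LEAST x. y < r x)"
  have x': "y < r x'" "x' \<le> x" "\<forall>x''<x'. \<not> y < r x''"
    unfolding x'_def using assms LeastI Least_le not_less_Least by metis+
  have "l x' \<le> y"
  proof (cases x')
    case (Suc k)
    then have "r k \<le> y" "l x' < r k" using x' rows(6)[of k] assms by auto
    then show ?thesis by simp
  qed (use rows(2) in simp)
  then have "(x', y) \<in> boxes" using x' assms(1) by (simp add: boxes_iff)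
  then show ?thesis ..
qed

lemma non_ambiguous_border: "non_ambiguous_tree (border_boxes boxes)"
  unfolding non_ambiguous_tree_iff all_dir_iff[of _ Lft]
proof (intro conjI ballI impI)
  have "boxes \<subseteq> {..<m} \<times> {..<r (m - 1)}"
  proof
    fix p assume "p \<in> boxes"
    then obtain x y where "p = (x, y)" "x < m" "y < r x" by (cases p) (auto simp: boxes_iff)
    moreover from this have "r x \<le> r (m - 1)" using rows(5)[of x "m - 1"] by simp
    ultimately show "p \<in> {..<m} \<times> {..<r (m - 1)}" by simp
  qed
  then have "finite boxes" by (rule finite_subset) simp
  then show "finite (border_boxes boxes)"
    by (rule rev_finite_subset) (auto simp: border_boxes_def)
  show "(0, 0) \<in> border_boxes boxes" using row_min_in_border[of 0] rows(1,2) by simp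
next
  fix p assume p: "p \<in> border_boxes boxes" "p \<noteq> (0, 0)"
  obtain x y where xy: "p = (x, y)" by (cases p)
  have boxes: "(x, y) \<in> boxes" "y = l x \<or> (\<forall>x'<x. (x', y) \<notin> boxes)" using p xy border_iff by auto
  \<comment> \<open>By the overlap with the previous row, a leftmost box other than the origin has a
    box above it. So only the origin is both leftmost in its row and topmost in its column.\<close>
  have *: "\<exists>x'<x. (x', y) \<in> boxes" if y: "y = l x"
  proof -
    have "x \<noteq> 0" using rows(2) y p xy by (cases x) auto
    then obtain x' where x': "x = Suc x'" by (cases x) auto
    then have "(x', y) \<in> boxes" using boxes(1) y rows(4)[of x' x] rows(6)[of x'] by (auto simp: boxes_iff)
    then show ?thesis using x' by blast
  qed
  then have "has_pred (border_boxes boxes) Rgt p \<longleftrightarrow> \<not> has_pred (border_boxes boxes) Lft p"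
  proof -
    have "l x < y \<longleftrightarrow> y \<noteq> l x" using boxes(1) by (auto simp: boxes_iff)
    moreover have "has_pred (border_boxes boxes) Rgt p \<longleftrightarrow> l x < y"
      using p(1) xy has_pred_border_Rgt by simp
    moreover have "has_pred (border_boxes boxes) Lft p \<longleftrightarrow> (\<exists>x'<x. (x', y) \<in> boxes)"
      using xy has_pred_border_Lft by simp
    ultimately show ?thesis using * boxes(2) by blast
  qed
  then show "has_pred (border_boxes boxes) (opp Lft) p \<longleftrightarrow> \<not> has_pred (border_boxes boxes) Lft p"
    "has_pred (border_boxes boxes) (opp (opp Lft)) p \<longleftrightarrow> \<not> has_pred (border_boxes boxes) (opp Lft) p"
    by auto
next
  fix p assume p: "p \<in> border_boxes boxes"
  obtain x y where xy: "p = (x, y)" by (cases p)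
  have boxes: "(x, y) \<in> boxes" using p xy border_iff by auto
  show "\<forall>k<coord Lft p. \<exists>q\<in>border_boxes boxes. coord Lft q = k"
  proof (intro allI impI)
    fix k assume "k < coord Lft p"
    then have "(k, l k) \<in> border_boxes boxes" using boxes xy by (intro row_min_in_border) (simp add: boxes_iff)
    then show "\<exists>q\<in>border_boxes boxes. coord Lft q = k" by force
  qed
  show "\<forall>k<coord (opp Lft) p. \<exists>q\<in>border_boxes boxes. coord (opp Lft) q = k"
  proof (intro allI impI)
    fix k assume "k < coord (opp Lft) p"
    then obtain x' where "(x', k) \<in> boxes" using ex_in_column[of x k] boxes xy by (auto simp: boxes_iff)
    then obtain x'' where "(x'', k) \<in> border_boxes boxes" by (rule column_min_in_border)
    then show "\<exists>q\<in>border_boxes boxes. coord (opp Lft) q = k" by force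
  qed
qed

lemma staircase_border: "staircase (border_boxes boxes)"
  unfolding staircase_def all_dir_iff[of _ Lft]
proof (intro conjI ballI impI non_ambiguous_border)
  fix p q assume pq: "p \<in> border_boxes boxes" "q \<in> border_boxes boxes"
  obtain x y x' y' where xy: "p = (x, y)" "q = (x', y')" by (cases p; cases q)
  have boxes: "(x, y) \<in> boxes" "(x', y') \<in> boxes" using pq xy border_iff by auto
  {
    assume "\<not> has_pred (border_boxes boxes) (opp Lft) p" "\<not> has_pred (border_boxes boxes) (opp Lft) q"
      "coord (opp Lft) p < coord (opp Lft) q"
    then have "l x < l x'" using boxes pq xy by (auto simp: has_pred_border_Rgt boxes_iff)
    then show "coord Lft p < coord Lft q" using xy boxes rows(4)[of x' x] by (force simp: boxes_iff)
  next
    assume "\<not> has_pred (border_boxes boxes) (opp (opp Lft)) p" "\<not> has_pred (border_boxes boxes) (opp (opp Lft)) q"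
      "coord (opp (opp Lft)) p < coord (opp (opp Lft)) q"
    \<comment> \<open>Since \<open>l x \<le> l x' \<le> y'\<close>, the box \<open>(x, y')\<close>
      can be missing only because \<open>r x \<le> y'\<close>, whence \<open>y < y'\<close>.\<close>
    then have "x < x'" "(x, y') \<notin> boxes" using xy by (auto simp: has_pred_border_Lft)
    then show "coord (opp Lft) p < coord (opp Lft) q"
      using xy boxes rows(4)[of x x'] by (force simp: boxes_iff)
  }
qed

text \<open>A cell added by the filling lies right of the left end of its row and, as
  \<open>r\<close> increases, inside the right end. Conversely, a box off the border arises from the
  leftmost box of its row and the topmost box of its column.\<close>

lemma filling_border: "filling (border_boxes boxes) = boxes"
proof (intro set_eqI iffI)
  fix p assume "p \<in> filling (border_boxes boxes)"
  then show "p \<in> boxes"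
  proof (unfold filling_def, elim UnE)
    assume "p \<in> {(x1, y2) |x1 y1 x2 y2. (x1, y1) \<in> border_boxes boxes \<and> (x2, y2) \<in> border_boxes boxes
      \<and> x2 < x1 \<and> y1 < y2}"
    then obtain x1 y1 x2 y2 where p: "p = (x1, y2)" "(x1, y1) \<in> boxes" "(x2, y2) \<in> boxes" "x2 < x1" "y1 < y2"
      using border_iff by auto
    then show ?thesis using rows(5)[of x2 x1] by (auto simp: boxes_iff)
  qed (auto simp: border_boxes_def)
next
  fix p assume p: "p \<in> boxes"
  obtain x y where xy: "p = (x, y)" by (cases p)
  show "p \<in> filling (border_boxes boxes)"
  proof (cases "p \<in> border_boxes boxes")
    case False
    then have "l x < y" "\<exists>x'<x. (x', y) \<in> boxes" using p xy by (auto simp: border_iff boxes_iff)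
    then obtain x' where "l x < y" "(x', y) \<in> boxes" "x' < x" by blast
    moreover then obtain x'' where "x'' \<le> x'" "(x'', y) \<in> border_boxes boxes"
      using column_min_in_border by blast
    moreover have "(x, l x) \<in> border_boxes boxes" using p xy row_min_in_border by (simp add: boxes_iff)
    ultimately show ?thesis unfolding filling_def xy by force
  qed (simp add: filling_def)
qed

end

lemma polyomino_border:
  assumes "P \<in> parallelogram_polyominoes"
  shows "staircase (border_boxes P)" "filling (border_boxes P) = P"
proof -
  obtain m l r where "row_profile m l r" "P = rows_between m l r"
    using polyomino_imp_rows_between[OF assms] .
  then interpret row_shape m l r by unfold_locales
  show "staircase (border_boxes P)" "filling (border_boxes P) = P"
    using staircase_border filling_border \<open>P = rows_between m l r\<close> by (simp_all add: boxes_def)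
qed

section \<open>From staircases back to polyominoes\<close>

lemma border_filling:
  assumes A: "non_ambiguous_tree A"
  shows "border_boxes (filling A) = A"
proof -
  \<comment> \<open>Every cell added by the filling has a cell of \<open>A\<close> to the left in
    its row and one above in its column, so leftmost and topmost cells stay the same.\<close>
  have row: "\<exists>y'\<le>y. (x, y') \<in> A \<and> ((x, y) \<in> A \<or> y' < y)" if "(x, y) \<in> filling A" for x y
    using that unfolding filling_def by (auto intro: less_imp_le)
  have col: "\<exists>x'\<le>x. (x', y) \<in> A \<and> ((x, y) \<in> A \<or> x' < x)" if "(x, y) \<in> filling A" for x y
    using that unfolding filling_def by (auto intro: less_imp_le)
  have sub: "A \<subseteq> filling A" by (simp add: filling_def)
  show ?thesis
  proof (intro set_eqI iffI)
    fix p assume p: "p \<in> border_boxes (filling A)"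
    obtain x y where xy: "p = (x, y)" by (cases p)
    then have f: "(x, y) \<in> filling A" using p by (simp add: border_boxes_def)
    show "p \<in> A"
    proof (rule ccontr)
      assume "p \<notin> A"
      then obtain x' y' where "x' < x" "(x', y) \<in> A" "y' < y" "(x, y') \<in> A"
        using row[OF f] col[OF f] xy by auto
      then show False using p xy sub by (auto simp: border_boxes_def)
    qed
  next
    fix p assume p: "p \<in> A"
    obtain x y where xy: "p = (x, y)" by (cases p)
    have "\<not> has_pred A Rgt p \<or> \<not> has_pred A Lft p"
      using has_pred_unique[OF A p] by blast
    then have "(\<forall>y'. (x, y') \<in> A \<longrightarrow> y \<le> y') \<or> (\<forall>x'. (x', y) \<in> A \<longrightarrow> x \<le> x')"
      using xy by (auto simp: has_pred_def not_less)
    then have "(\<forall>y'. (x, y') \<in> filling A \<longrightarrow> y \<le> y') \<or> (\<forall>x'. (x', y) \<in> filling A \<longrightarrow> x \<le> x')"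
      using row col by (meson le_trans)
    then show "p \<in> border_boxes (filling A)"
      using p sub xy by (auto simp: border_boxes_def)
  qed
qed

lemma staircaseD:
  assumes "staircase A" "p \<in> A" "q \<in> A" "\<not> has_pred A (opp d) p" "\<not> has_pred A (opp d) q"
    "coord (opp d) p < coord (opp d) q"
  shows "coord d p < coord d q"
  using assms unfolding staircase_def by blast

text \<open>Row \<open>x\<close> of the filling starts at the leftmost cell of \<open>A\<close> in
  that row and extends to the largest column met in rows up to \<open>x\<close>. So \<open>r\<close>
  increases by construction, while \<open>l\<close> increases by the staircase condition.\<close>

lemma staircase_filling:
  assumes A: "staircase A"
  shows "filling A \<in> parallelogram_polyominoes"
proof -
  have nat: "non_ambiguous_tree A" using A by (simp add: staircase_def)
  then have fin: "finite A" and origin: "(0, 0) \<in> A"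
    and down: "\<And>x y k. (x, y) \<in> A \<Longrightarrow> k < x \<Longrightarrow> \<exists>y'. (k, y') \<in> A"
      "\<And>x y k. (x, y) \<in> A \<Longrightarrow> k < y \<Longrightarrow> \<exists>x'. (x', k) \<in> A"
    unfolding non_ambiguous_tree_def by fastforce+
  define m where "m = Suc (Max (fst ` A))"
  define l where "l x = (LEAST y. (x, y) \<in> A)" for x
  define t where "t y = (LEAST x. (x, y) \<in> A)" for y
  define r where "r x = Suc (Max {y. \<exists>x'\<le>x. (x', y) \<in> A})" for x
  have m: "x < m" if "(x, y) \<in> A" for x y
    unfolding m_def less_Suc_eq_le using fin that by (intro Max_ge) force+
  have row: "\<exists>y. (x, y) \<in> A" if "x < m" for x
  proof -
    have "Max (fst ` A) \<in> fst ` A" using fin origin by (intro Max_in) auto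
    then obtain y where "(Max (fst ` A), y) \<in> A" by auto
    then show ?thesis using down(1)[of _ y x] that by (cases "x = Max (fst ` A)") (auto simp: m_def)
  qed
  have l: "(x, l x) \<in> A" if "x < m" for x
    unfolding l_def using row[OF that] by (rule LeastI_ex)
  have l_le: "l x \<le> y" if "(x, y) \<in> A" for x y
    unfolding l_def using that by (rule Least_le)
  have t: "(t y, y) \<in> A" "t y \<le> x" if "(x, y) \<in> A" for x y
    unfolding t_def using that by (auto intro: LeastI Least_le)
  have fin_r: "finite {y. \<exists>x'\<le>x. (x', y) \<in> A}" for x
    by (rule finite_subset[of _ "snd ` A"]) (use fin in force)+
  have r_gt: "y < r x" if "(x', y) \<in> A" "x' \<le> x" for x x' y
    unfolding r_def using fin_r[of x] that by (auto simp: less_Suc_eq_le intro: Max_ge)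
  have r_ex: "\<exists>x' y'. x' \<le> x \<and> y \<le> y' \<and> (x', y') \<in> A" if "y < r x" "x < m" for x y
  proof -
    have "Max {y. \<exists>x'\<le>x. (x', y) \<in> A} \<in> {y. \<exists>x'\<le>x. (x', y) \<in> A}"
      using fin_r l[OF that(2)] by (intro Max_in) auto
    then show ?thesis using that(1) unfolding r_def by (auto simp: less_Suc_eq_le)
  qed
  have no_left: "\<not> has_pred A Rgt (x, l x)" for x
    using l_le by (auto simp: has_pred_def not_less)
  have no_above: "\<not> has_pred A Lft (t y, y)" for y
    using t(2) by (auto simp: has_pred_def not_less)
  have stair_l: "l x \<le> l x'" if "x \<le> x'" "x' < m" for x x'
  proof (rule ccontr)
    assume "\<not> l x \<le> l x'"
    then have "x' < x"
      using staircaseD[OF A l[of x'] l[of x], of Lft] no_left[of x] no_left[of x'] that by simp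
    then show False using that by simp
  qed
  have stair_t: "t y \<le> t y'" if "y \<le> y'" "(x, y) \<in> A" "(x', y') \<in> A" for x x' y y'
  proof (rule ccontr)
    assume "\<not> t y \<le> t y'"
    then have "y' < y"
      using staircaseD[OF A t(1)[OF that(3)] t(1)[OF that(2)], of Rgt] no_above[of y] no_above[of y']
      by simp
    then show False using that by simp
  qed
  have "row_profile m l r"
    unfolding row_profile_def
  proof (intro conjI allI impI)
    show "m > 0" by (simp add: m_def)
    show "l 0 = 0" using l_le[OF origin] by simp
    show "l x < r x" if "x < m" for x using r_gt[OF l[OF that]] by simp
    show "l x \<le> l x'" if "x \<le> x'" "x' < m" for x x' using stair_l that .
    show "r x \<le> r x'" if "x \<le> x'" "x' < m" for x x'
    proof (rule ccontr)
      assume "\<not> r x \<le> r x'"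
      then have "r x' < r x" "x < m" using that by auto
      then obtain x'' y' where "x'' \<le> x" "r x' \<le> y'" "(x'', y') \<in> A"
        using r_ex by blast
      then show False using r_gt[of x'' y' x'] that by simp
    qed
    show "l (Suc x) < r x" if "Suc x < m" for x
    proof -
      \<comment> \<open>Having no predecessor in its row, this cell has one in its column, in a row
        up to \<open>x\<close>; this gives the overlap.\<close>
      have "has_pred A Lft (Suc x, l (Suc x))"
        using has_pred_opp_iff[OF nat l[OF that], of Lft] no_left[of "Suc x"] by simp
      then obtain x' where "(x', l (Suc x)) \<in> A" "x' \<le> x" by (auto simp: has_pred_def)
      then show ?thesis by (rule r_gt)
    qed
  qed
  moreover have "filling A = rows_between m l r"
  proof (intro set_eqI iffI)
    fix p assume p: "p \<in> filling A"
    obtain x y where xy: "p = (x, y)" by (cases p)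
    have "x < m \<and> l x \<le> y \<and> y < r x"
      using p xy m l_le r_gt unfolding filling_def
      by (auto intro: less_imp_le order.trans[OF l_le])
    then show "p \<in> rows_between m l r" using xy by (simp add: rows_between_def)
  next
    fix p assume "p \<in> rows_between m l r"
    then obtain x y where xy: "p = (x, y)" "x < m" "l x \<le> y" "y < r x" by (auto simp: rows_between_def)
    show "p \<in> filling A"
    proof (cases "(x, y) \<in> A")
      case False
      then have "l x < y" using l xy by (metis le_neq_implies_less)
      \<comment> \<open>Column tops move weakly down and some cell in rows up to \<open>x\<close>
        lies in a column \<open>y' \<ge> y\<close>. Hence the top of column \<open>y\<close> is
        above row \<open>x\<close>, and together with \<open>(x, l x)\<close> it generates
        \<open>(x, y)\<close>.\<close>
      obtain x' y' where x'y': "x' \<le> x" "y \<le> y'" "(x', y') \<in> A" using r_ex xy by blast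
      then obtain x'' where "(x'', y) \<in> A" using down(2) le_neq_implies_less by metis
      then have "(t y, y) \<in> A" "t y \<le> t y'" using t(1) stair_t x'y' by auto
      moreover have "t y' \<le> x" using t(2)[OF x'y'(3)] x'y'(1) by simp
      moreover have "t y \<noteq> x" using False t(1) \<open>(x'', y) \<in> A\<close> by metis
      ultimately have "t y < x" by simp
      then show ?thesis
        unfolding filling_def using xy l[OF xy(2)] \<open>l x < y\<close> \<open>(t y, y) \<in> A\<close> by blast
    qed (simp add: filling_def xy)
  qed
  ultimately show ?thesis using rows_between_in_polyominoes by metis
qed

section \<open>The two maps are mutually inverse\<close>

theorem proposition24:
  shows "Psi \<in> parallelogram_polyominoes \<rightarrow> binary_trees
       \<and> Lambda \<in> binary_trees \<rightarrow> parallelogram_polyominoes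
       \<and> (\<forall>P\<in>parallelogram_polyominoes. Lambda (Psi P) = P)
       \<and> (\<forall>T\<in>binary_trees. Psi (Lambda T) = T)"
proof (intro conjI ballI funcsetI)
  fix P assume P: "P \<in> parallelogram_polyominoes"
  have stair: "staircase (border_boxes P)" using polyomino_border(1)[OF P] .
  then obtain T where T: "is_underlying_tree (border_boxes P) T"
    using ex_underlying_tree unfolding staircase_def by blast
  then have Psi: "Psi P = T" by (simp add: Psi_def underlying_tree_eq)
  show "Psi P \<in> binary_trees" using T Psi by (simp add: is_underlying_tree_iff)
  obtain f where f: "tree_iso T (border_boxes P) f"
    using T by (auto simp: is_underlying_tree_iff)
  then have "border_boxes P = f ` vertices T"
    by (simp add: tree_iso_def bij_betw_def)
  also have "\<dots> = place_tree T"
    unfolding place_tree_def using tree_iso_staircase_eq_place[OF stair f] by (rule image_cong[OF refl])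
  finally show "Lambda (Psi P) = P"
    using polyomino_border(2)[OF P] Psi by (simp add: Lambda_def)
next
  fix T :: "unit tree" assume T: "T \<in> binary_trees"
  have stair: "staircase (place_tree T)" using T by (rule staircase_place_tree)
  then show "Lambda T \<in> parallelogram_polyominoes"
    unfolding Lambda_def by (rule staircase_filling)
  have "Psi (Lambda T) = underlying_tree (place_tree T)"
    unfolding Psi_def Lambda_def using stair by (simp add: border_filling staircase_def)
  also have "\<dots> = T"
    using is_underlying_tree_place_tree[OF T] by (rule underlying_tree_eq)
  finally show "Psi (Lambda T) = T" .
qed

end
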